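(* Let $S\subseteq\mathbb{T}$ be a sub-semifield and let $\mathcal{M}$ be a toric monoid, corresponding to a strongly convex rational polyhedral cone $\sigma\subseteq N_{\mathbb R}$. Let $E$ be a congruence on $S[\mathcal M]$ that has a finite tropical basis. Suppose $(f,g)\in S[\mathcal M]^2$ is such that $\widetilde f(w)=\widetilde g(w)$ for all $w\in\widetilde V(E)$. Then there are $i\in\mathbb Z_{\ge0}$ and $h\in S[\mathcal M]$ such that $$\big([(f+g)^i+h]f,\ [(f+g)^i+h]g\big)\in E.$$
   Context: Semirings are commutative, with $0$ and $1$, and additively idempotent. $\mathbb{T}=\mathbb{R}\cup\{-\infty\}$ is the tropical semifield (addition is max, multiplication is usual addition, $0_{\mathbb T}=-\infty$); $\log:\mathbb{T}\to\mathbb{R}\cup\{-\infty\}$ is the tautological identification, with $\log 0_{\mathbb T}=-\infty$. Toric data: $M$ is a finitely generated free abelian group, $M_{\mathbb R}=M\otimes\mathbb R$, $N_{\mathbb R}=\mathrm{Hom}(M,\mathbb R)$ with pairing $\langle v,u\rangle=v(u)$. For $\sigma\subseteq N_{\mathbb R}$ a strongly convex rational polyhedral cone, $\sigma^\vee=\{u\in M_{\mathbb R}:\langle v,u\rangle\le 0\ \forall v\in\sigma\}$, and the toric monoid corresponding to $\sigma$ is $\mathcal{M}=\sigma^\vee\cap M$. $N_{\mathbb R}(\sigma)$ is the set of monoid homomorphisms $\mathcal{M}\to(\mathbb R\cup\{-\infty\},+)$, and $\langle x,u\rangle=x(u)$ for $x\in N_{\mathbb R}(\sigma)$, $u\in\mathcal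 M$. For $f=\sum_u f_u\chi^u\in S[\mathcal M]$ and $(r,x)\in\mathbb R_{\ge0}\times N_{\mathbb R}(\sigma)$, $\widetilde f(r,x)=\max_{u\in\mathrm{supp}(f)}\left(r\log(f_u)+\langle x,u\rangle\right)$ (equal to $-\infty$ if $f=0$). For $E\subseteq S[\mathcal M]^2$, $\widetilde V(E)=\{w\in\mathbb R_{\ge0}\times N_{\mathbb R}(\sigma):\widetilde f(w)=\widetilde g(w)\ \forall (f,g)\in E\}$. A congruence on a semiring is an equivalence relation respecting the operations. A congruence $E$ on $S[\mathcal M]$ has a finite tropical basis if there are $(f_1,g_1),\dots,(f_r,g_r)\in E$ with $\widetilde V(E)=\widetilde V(\{(f_1,g_1),\dots,(f_r,g_r)\})$. *)

theory Defs
  imports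
    Complex_Main
    "HOL-Library.Extended_Real"
    "HOL-Library.FuncSet"
    "HOL-Library.Poly_Mapping"
begin

section \<open>The tropical semifield\<close>

text \<open>
  The carrier is the set of reals together with \<open>-\<infinity>\<close>. The representation map
  \<open>trop_log\<close> is the tautological identification of the tropical semifield with this set; in
  particular, it sends the semiring zero to \<open>-\<infinity>\<close> and the semiring one to the real number 0.
\<close>

typedef trop = "{x :: ereal. x \<noteq> \<infinity>}" morphisms trop_log Abs_trop
  by (rule exI[of _ 0]) simp

setup_lifting type_definition_trop

instantiation trop :: comm_semiring_1
begin

lift_definition zero_trop :: trop is "-\<infinity>" by simp
lift_definition one_trop :: trop is 0 by simp
lift_definition plus_trop :: "trop \<Rightarrow> trop \<Rightarrow> trop" is max by (simp add: max_def)
lift_definition times_trop :: "trop \<Rightarrow> trop \<Rightarrow> trop" is "(+)" by simp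

instance
proof
  fix a b c :: trop
  show "a * b * c = a * (b * c)" by transfer (simp add: add.assoc)
  show "a * b = b * a" by transfer (simp add: add.commute)
  show "1 * a = a" by transfer simp
  show "a + b + c = a + (b + c)" by transfer (simp add: max.assoc)
  show "a + b = b + a" by transfer (simp add: max.commute)
  show "0 + a = a" by transfer (simp add: max_def)
  show "0 * a = 0" by transfer (simp add: plus_ereal.simps)
  show "a * 0 = 0" by transfer (simp add: plus_ereal.simps)
  show "(a + b) * c = a * c + b * c"
  proof transfer
    fix a b c :: ereal
    show "max a b + c = max (a + c) (b + c)"
      by (metis add_right_mono linear max.absorb1 max.absorb2)
  qed
  show "(0::trop) \<noteq> 1" by transfer simp
qed

end

definition sub_semifield :: "trop set \<Rightarrow> bool" where
  "sub_semifield S \<longleftrightarrow>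
     0 \<in> S \<and> 1 \<in> S \<and>
     (\<forall>a\<in>S. \<forall>b\<in>S. a + b \<in> S \<and> a * b \<in> S) \<and>
     (\<forall>a\<in>S. a \<noteq> 0 \<longrightarrow> (\<exists>b\<in>S. a * b = 1))"


section \<open>Finitely generated free abelian groups\<close>

text \<open>
  The \<open>\<int>\<close>-module structure of an abelian group; at most one of the two sums is nonempty.
\<close>

definition zscale :: "int \<Rightarrow> 'm::ab_group_add \<Rightarrow> 'm" where
  "zscale k u = (\<Sum>i<nat k. u) - (\<Sum>i<nat (- k). u)"

lemma zscale_diff: "zscale (int a - int b) u = (\<Sum>i<a. u) - (\<Sum>i<b. u)"
proof -
  have add: "(\<Sum>i<m + n. u) = (\<Sum>i<m. u) + (\<Sum>i<n. u)" for m n :: nat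
    by (induction n) (simp_all add: algebra_simps)
  show ?thesis
  proof (cases "b \<le> a")
    case True
    then obtain c where "a = b + c" using le_Suc_ex by blast
    then show ?thesis by (simp add: zscale_def add)
  next
    case False
    then obtain c where "b = a + c" using le_Suc_ex nat_le_linear by blast
    then show ?thesis by (simp add: zscale_def add)
  qed
qed

lemma zscale_left_distrib: "zscale (k + l) u = zscale k u + zscale l u"
proof -
  have add: "(\<Sum>i<m + n. u) = (\<Sum>i<m. u) + (\<Sum>i<n. u)" for m n :: nat
    by (induction n) (simp_all add: algebra_simps)
  obtain a b c d where kl: "k = int a - int b" "l = int c - int d"
    by (metis int_diff_cases)
  have "k + l = int (a + c) - int (b + d)" using kl by simp
  then show ?thesis
    by (simp only: zscale_diff kl add) (simp add: algebra_simps)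
qed

lemma zscale_right_distrib: "zscale k (u + v) = zscale k u + zscale k v"
  by (simp add: zscale_def sum.distrib algebra_simps)

lemma zscale_scale: "zscale k (zscale l u) = zscale (k * l) u"
proof -
  interpret s: additive "\<lambda>k. zscale k u"
    by standard (rule zscale_left_distrib)
  have nat: "zscale (int n) v = (\<Sum>i<n. v)" for n and v :: 'a
    by (simp add: zscale_def)
  have natscale: "zscale (int n) (zscale l u) = zscale (int n * l) u" for n
  proof -
    have "(\<Sum>i<n. zscale l u) = zscale (int n * l) u"
      by (induction n) (simp_all add: s.zero s.add distrib_right add.commute)
    then show ?thesis by (simp add: nat)
  qed
  interpret t: additive "\<lambda>k. zscale k (zscale l u)"
    by standard (rule zscale_left_distrib)
  show ?thesis
  proof (cases k)
    case (nonneg n)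
    show ?thesis unfolding nonneg by (rule natscale)
  next
    case (neg n)
    show ?thesis
      unfolding neg t.minus s.minus mult_minus_left by (simp only: natscale)
  qed
qed

lemma module_zscale: "module (zscale :: int \<Rightarrow> 'm::ab_group_add \<Rightarrow> 'm)"
  by standard
     (simp_all add: zscale_right_distrib zscale_left_distrib zscale_scale, simp add: zscale_def)

text \<open>The rank is allowed to be 0 (\<open>B = {}\<close>).\<close>

definition fg_free :: "'m::ab_group_add itself \<Rightarrow> bool" where
  "fg_free _ \<longleftrightarrow>
     (\<exists>B :: 'm set. finite B \<and> \<not> module.dependent zscale B \<and> module.span zscale B = UNIV)"


section \<open>Toric data\<close>

text \<open>
  The group \<open>M\<close> is the type \<open>'m\<close>. Elements of \<open>N_\<real> = Hom(M, \<real>)\<close> are additive functions, the pairing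
  of \<open>v\<close> with \<open>u\<close> being \<open>v u\<close>, and the lattice \<open>N = Hom(M, \<int>)\<close> consists of the integer-valued ones.
\<close>

definition dual_space :: "('m::ab_group_add \<Rightarrow> real) set" where
  "dual_space = {v. Modules.additive v}"

definition dual_lattice :: "('m::ab_group_add \<Rightarrow> real) set" where
  "dual_lattice = {v \<in> dual_space. range v \<subseteq> \<int>}"

definition rational_polyhedral_cone :: "('m::ab_group_add \<Rightarrow> real) set \<Rightarrow> bool" where
  "rational_polyhedral_cone \<sigma> \<longleftrightarrow>
     (\<exists>V \<subseteq> dual_lattice. finite V \<and>
        \<sigma> = {\<lambda>u. \<Sum>v\<in>V. c v * v u | c. \<forall>v\<in>V. (0::real) \<le> c v})"

definition strongly_convex :: "('m::ab_group_add \<Rightarrow> real) set \<Rightarrow> bool" where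
  "strongly_convex \<sigma> \<longleftrightarrow> (\<forall>v. v \<in> \<sigma> \<and> (\<lambda>u. - v u) \<in> \<sigma> \<longrightarrow> v = (\<lambda>u. 0))"

text \<open>
  The toric monoid \<open>\<sigma>\<^sup>\<or> \<inter> M\<close>. Note the sign convention for the dual cone: pairings are \<open>\<le> 0\<close>.
\<close>

definition toric_monoid :: "('m::ab_group_add \<Rightarrow> real) set \<Rightarrow> 'm set" where
  "toric_monoid \<sigma> = {u. \<forall>v\<in>\<sigma>. v u \<le> 0}"

text \<open>
  \<open>N_\<real>(\<sigma>)\<close>: the monoid homomorphisms from the toric monoid to \<open>(\<real> \<union> {-\<infinity>}, +)\<close>. Such a map is
  represented by the extension that is \<open>undefined\<close> outside the toric monoid, so that different
  elements of this set are different homomorphisms.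
\<close>

definition extended_space :: "('m::ab_group_add \<Rightarrow> real) set \<Rightarrow> ('m \<Rightarrow> ereal) set" where
  "extended_space \<sigma> =
     {x \<in> toric_monoid \<sigma> \<rightarrow>\<^sub>E {y. y \<noteq> \<infinity>}.
        x 0 = 0 \<and>
        (\<forall>u\<in>toric_monoid \<sigma>. \<forall>u'\<in>toric_monoid \<sigma>. x (u + u') = x u + x u')}"


section \<open>Monoid semirings, congruences and tropical vanishing loci\<close>

text \<open>
  The monoid semiring \<open>S[\<M>]\<close>, as a subsemiring of the semiring \<^typ>\<open>'m \<Rightarrow>\<^sub>0 trop\<close> of all finitely
  supported functions with the convolution product.
\<close>

definition monoid_semiring :: "trop set \<Rightarrow> 'm::ab_group_add set \<Rightarrow> ('m \<Rightarrow>\<^sub>0 trop) set" where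
  "monoid_semiring S \<M> = {f. Poly_Mapping.keys f \<subseteq> \<M> \<and> (\<forall>u. Poly_Mapping.lookup f u \<in> S)}"

definition congruence :: "'a::comm_semiring_1 set \<Rightarrow> ('a \<times> 'a) set \<Rightarrow> bool" where
  "congruence R E \<longleftrightarrow>
     equiv R E \<and>
     (\<forall>a b c d. (a, b) \<in> E \<and> (c, d) \<in> E \<longrightarrow> (a + c, b + d) \<in> E \<and> (a * c, b * d) \<in> E)"

definition trop_eval :: "('m::ab_group_add \<Rightarrow>\<^sub>0 trop) \<Rightarrow> real \<times> ('m \<Rightarrow> ereal) \<Rightarrow> ereal" where
  "trop_eval f = (\<lambda>(r, x).
     if f = 0 then -\<infinity> else Max ((\<lambda>u. ereal r * trop_log (Poly_Mapping.lookup f u) + x u) ` Poly_Mapping.keys f))"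

definition trop_locus ::
    "('m::ab_group_add \<Rightarrow> real) set \<Rightarrow> (('m \<Rightarrow>\<^sub>0 trop) \<times> ('m \<Rightarrow>\<^sub>0 trop)) set
      \<Rightarrow> (real \<times> ('m \<Rightarrow> ereal)) set" where
  "trop_locus \<sigma> E =
     {w \<in> {0..} \<times> extended_space \<sigma>. \<forall>(f, g)\<in>E. trop_eval f w = trop_eval g w}"

definition has_finite_tropical_basis ::
    "('m::ab_group_add \<Rightarrow> real) set \<Rightarrow> (('m \<Rightarrow>\<^sub>0 trop) \<times> ('m \<Rightarrow>\<^sub>0 trop)) set \<Rightarrow> bool" where
  "has_finite_tropical_basis \<sigma> E \<longleftrightarrow>
     (\<exists>F \<subseteq> E. finite F \<and> trop_locus \<sigma> E = trop_locus \<sigma> F)"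

end

theory Submission
  imports Defs
begin

text \<open>
  An additively idempotent semiring carries the order \<open>p \<le> q \<longleftrightarrow> p + q = q\<close>, so a congruence \<open>E\<close> is the
  same thing as a compatible preorder, in which \<open>(p, q) \<in> E\<close> means that \<open>p\<close> and \<open>q\<close> are equivalent.
  Call \<open>T\<close> the set of all \<open>(f + g)\<^sup>i + h\<close>; it is closed under products and under adding anything.
  Assume that no \<open>t \<in> T\<close> makes \<open>tf\<close> and \<open>tg\<close> equivalent. The proof constructs a point of the locus
  of \<open>E\<close> at which \<open>f\<close> and \<open>g\<close> have different values.

  By Zorn's lemma (\<open>exists_maximal_separating\<close>) the preorder of \<open>E\<close> extends to a maximal
  preorder \<open>\<preceq>\<close> among those under which still no \<open>t \<in> T\<close> makes \<open>tf\<close> and \<open>tg\<close> equivalent. Every further relation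
  imposed on \<open>\<preceq>\<close> therefore yields such a \<open>t\<close>, and choosing the relation well shows that the quotient
  by \<open>\<preceq>\<close> is totally ordered (\<open>total\<close>) and that all its nonzero elements are cancellable (\<open>cancel\<close>).
  In other words, the quotient is by a prime congruence.

  In such an order a polynomial is equivalent to its largest term. The exponents whose monomials do
  not vanish in the quotient form a face of the monoid, and on terms supported there \<open>\<preceq>\<close> is a group
  preorder on pairs of a logarithm of a coefficient and an exponent. It may be lexicographic, hence
  not given by a single point. But only finitely many comparisons between terms matter: those
  between the terms of \<open>f\<close>, \<open>g\<close> and the finite tropical basis. They are a system of weak and strict
  linear inequalities in the unknown point \<open>(r, x)\<close>. Eliminating the coordinates of \<open>x\<close> one by one
  (\<open>fourier_motzkin\<close>) uses integer multipliers only, because exponents are integer vectors, so every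
  derived inequality is again a comparison that holds under \<open>\<preceq>\<close>. At the end only conditions on \<open>r\<close>
  remain. Since \<open>\<preceq>\<close> contains the order of the coefficients, they are satisfied by \<open>r = 1\<close>, unless
  \<open>\<preceq>\<close> identifies two different constants; then it identifies all nonzero ones, and \<open>r = 0\<close> works. Setting \<open>x\<close> to \<open>-\<infinity>\<close> off the face gives a
  point of the extended space whose values order all these polynomials exactly as \<open>\<preceq>\<close> does
  (\<open>realized_by_point\<close>). It lies on the locus of the basis, and it separates \<open>f\<close> from \<open>g\<close>.
\<close>

section \<open>Compatible preorders on a semiring\<close>

text \<open>
  The order-theoretic form of a congruence with idempotent quotient: \<open>a + b\<close> is a least upper bound
  of \<open>a\<close> and \<open>b\<close> up to equivalence. Working with preorders avoids quotient semirings, and the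
  extensions needed below have simple descriptions as preorders.
\<close>
locale semiring_preorder =
  fixes R :: "'a::comm_semiring_1 set" and le :: "'a \<Rightarrow> 'a \<Rightarrow> bool" (infix "\<preceq>" 50)
  assumes zero_closed [simp]: "0 \<in> R"
    and one_closed [simp]: "1 \<in> R"
    and add_closed [simp]: "a \<in> R \<Longrightarrow> b \<in> R \<Longrightarrow> a + b \<in> R"
    and mult_closed [simp]: "a \<in> R \<Longrightarrow> b \<in> R \<Longrightarrow> a * b \<in> R"
    and closed: "a \<preceq> b \<Longrightarrow> a \<in> R \<and> b \<in> R"
    and le_add_right: "a \<in> R \<Longrightarrow> b \<in> R \<Longrightarrow> a \<preceq> a + b"
    and trans [trans]: "a \<preceq> b \<Longrightarrow> b \<preceq> c \<Longrightarrow> a \<preceq> c"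
    and add_least: "a \<preceq> c \<Longrightarrow> b \<preceq> c \<Longrightarrow> a + b \<preceq> c"
    and mult_right_mono: "a \<preceq> b \<Longrightarrow> c \<in> R \<Longrightarrow> a * c \<preceq> b * c"
begin

lemma refl [simp]: "a \<in> R \<Longrightarrow> a \<preceq> a"
  using le_add_right[of a 0] by simp

lemma zero_least [simp]: "a \<in> R \<Longrightarrow> 0 \<preceq> a"
  using le_add_right[of 0 a] by simp

lemma le_add_left: "a \<in> R \<Longrightarrow> b \<in> R \<Longrightarrow> b \<preceq> a + b"
  using le_add_right[of b a] by (simp add: add.commute)

lemma add_mono: "a \<preceq> b \<Longrightarrow> c \<preceq> d \<Longrightarrow> a + c \<preceq> b + d"
  by (meson add_least closed le_add_left le_add_right trans)

lemma mult_left_mono: "a \<preceq> b \<Longrightarrow> c \<in> R \<Longrightarrow> c * a \<preceq> c * b"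
  using mult_right_mono[of a b c] by (simp add: mult.commute)

lemma mult_mono: "a \<preceq> b \<Longrightarrow> c \<preceq> d \<Longrightarrow> a * c \<preceq> b * d"
  by (meson closed mult_left_mono mult_right_mono trans)

lemma power_closed [simp]: "a \<in> R \<Longrightarrow> a ^ n \<in> R"
  by (induction n) auto

lemma power_mono: "a \<preceq> b \<Longrightarrow> a ^ n \<preceq> b ^ n"
  by (induction n) (auto intro: mult_mono)

lemma sum_least: "finite A \<Longrightarrow> c \<in> R \<Longrightarrow> (\<And>i. i \<in> A \<Longrightarrow> p i \<preceq> c) \<Longrightarrow> sum p A \<preceq> c"
  by (induction A rule: finite_induct) (auto intro: add_least)

text \<open>
  Expand the power on the left: a monomial of degree \<open>m + n\<close> in \<open>a\<close> and \<open>b\<close> is divisible by \<open>a ^ m\<close> or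
  by \<open>b ^ n\<close>. This is what combines the two cases \<open>a \<preceq> b\<close> and \<open>b \<preceq> a\<close> in the proof of totality.
\<close>
lemma power_add_le:
  assumes "a \<in> R" "b \<in> R"
  shows "(a + b) ^ (m + n) \<preceq> (a + b) ^ n * a ^ m + (a + b) ^ m * b ^ n"
proof (induction "m + n" arbitrary: m n rule: less_induct)
  case less
  show ?case
  proof (cases "m = 0 \<or> n = 0")
    case True
    then show ?thesis
      using assms le_add_right[of "(a + b) ^ n" "b ^ n"] le_add_left[of "a ^ m" "(a + b) ^ m"]
      by auto
  next
    case False
    then obtain m' n' where mn: "m = Suc m'" "n = Suc n'"
      by (metis not0_implies_Suc)
    let ?s = "a + b"
    let ?B = "?s ^ n * a ^ m + ?s ^ m * b ^ n"
    have up: "c * ?s ^ k * d \<preceq> ?s ^ Suc k * d" if "c \<preceq> ?s" "d \<in> R" for c d k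
      using mult_mono[OF mult_mono[OF that(1), of "?s ^ k" "?s ^ k"], of d d] that assms by simp
    have a: "a \<preceq> ?s" and b: "b \<preceq> ?s" using assms by (auto intro: le_add_left le_add_right)
    have "a * ?s ^ (m' + n) \<preceq> a * (?s ^ n * a ^ m' + ?s ^ m' * b ^ n)"
      using less[of m' n] mn assms by (intro mult_left_mono) auto
    also have "a * (?s ^ n * a ^ m' + ?s ^ m' * b ^ n) = ?s ^ n * a ^ m + a * ?s ^ m' * b ^ n"
      by (simp add: mn algebra_simps)
    also have "\<dots> \<preceq> ?B"
      using up[OF a, of "b ^ n" m'] assms mn by (intro add_mono) auto
    finally have 1: "a * ?s ^ (m' + n) \<preceq> ?B" .
    have "b * ?s ^ (m + n') \<preceq> b * (?s ^ n' * a ^ m + ?s ^ m * b ^ n')"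
      using less[of m n'] mn assms by (intro mult_left_mono) auto
    also have "b * (?s ^ n' * a ^ m + ?s ^ m * b ^ n') = b * ?s ^ n' * a ^ m + ?s ^ m * b ^ n"
      by (simp add: mn algebra_simps)
    also have "\<dots> \<preceq> ?B"
      using up[OF b, of "a ^ m" n'] assms mn by (intro add_mono) auto
    finally have 2: "b * ?s ^ (m + n') \<preceq> ?B" .
    have "?s ^ (m + n) = a * ?s ^ (m' + n) + b * ?s ^ (m + n')"
      by (simp add: mn distrib_right)
    then show ?thesis using add_least[OF 1 2] by simp
  qed
qed

text \<open>
  Three ways of enlarging a preorder: make \<open>c\<close> cancellable once, force \<open>c \<preceq> 0\<close>, and force \<open>a \<preceq> b\<close>.
\<close>
definition colon :: "'a \<Rightarrow> 'a \<Rightarrow> 'a \<Rightarrow> bool" where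
  "colon c x y \<longleftrightarrow> x \<in> R \<and> y \<in> R \<and> c * x \<preceq> c * y"

lemma colon_preorder:
  assumes c: "c \<in> R" shows "semiring_preorder R (colon c)"
proof
  show "colon c (a * d) (b * d)" if "colon c a b" "d \<in> R" for a b d
    using that mult_right_mono[of "c * a" "c * b" d] by (simp add: colon_def mult.assoc)
  show "colon c x z" if "colon c x y" "colon c y z" for x y z
    using that trans[of "c * x" "c * y" "c * z"] by (simp add: colon_def)
qed (use c in \<open>simp_all add: colon_def distrib_left le_add_right add_least\<close>)

lemma colon_extends: "c \<in> R \<Longrightarrow> \<forall>x y. x \<preceq> y \<longrightarrow> colon c x y"
  by (simp add: colon_def mult_left_mono closed)

definition adjoin_null :: "'a \<Rightarrow> 'a \<Rightarrow> 'a \<Rightarrow> bool" where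
  "adjoin_null c x y \<longleftrightarrow> x \<in> R \<and> y \<in> R \<and> (\<exists>d\<in>R. x \<preceq> y + c * d)"

lemma adjoin_null_preorder:
  assumes c: "c \<in> R" shows "semiring_preorder R (adjoin_null c)"
proof
  show "adjoin_null c a (a + b)" if "a \<in> R" "b \<in> R" for a b
    using that c by (auto simp: adjoin_null_def intro!: bexI[of _ 0] le_add_right)
next
  fix x y z assume "adjoin_null c x y" "adjoin_null c y z"
  then obtain d e where R: "x \<in> R" "y \<in> R" "z \<in> R" "d \<in> R" "e \<in> R"
    and d: "x \<preceq> y + c * d" and e: "y \<preceq> z + c * e" by (auto simp: adjoin_null_def)
  note d also have "y + c * d \<preceq> (z + c * e) + c * d"
    using e R c by (intro add_mono) auto
  also have "\<dots> = z + c * (e + d)" by (simp add: algebra_simps)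
  finally show "adjoin_null c x z" using R by (auto simp: adjoin_null_def)
next
  fix x y z assume "adjoin_null c x z" "adjoin_null c y z"
  then obtain d e where R: "x \<in> R" "y \<in> R" "z \<in> R" "d \<in> R" "e \<in> R"
    and d: "x \<preceq> z + c * d" and e: "y \<preceq> z + c * e" by (auto simp: adjoin_null_def)
  have *: "z + c * d \<preceq> z + c * (d + e)" "z + c * e \<preceq> z + c * (d + e)"
    using R c by (auto intro!: add_mono mult_left_mono le_add_left le_add_right)
  have "x + y \<preceq> z + c * (d + e)"
    using trans[OF d *(1)] trans[OF e *(2)] by (rule add_least)
  then show "adjoin_null c (x + y) z" using R by (auto simp: adjoin_null_def)
next
  fix x y z assume "adjoin_null c x y" and z: "z \<in> R"
  then obtain d where R: "x \<in> R" "y \<in> R" "d \<in> R"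
    and d: "x \<preceq> y + c * d" by (auto simp: adjoin_null_def)
  have "x * z \<preceq> y * z + c * (d * z)"
    using mult_right_mono[OF d z] by (simp add: algebra_simps)
  then show "adjoin_null c (x * z) (y * z)" using R z by (auto simp: adjoin_null_def)
qed (use c in \<open>auto simp: adjoin_null_def\<close>)

lemma adjoin_null_extends: "c \<in> R \<Longrightarrow> \<forall>x y. x \<preceq> y \<longrightarrow> adjoin_null c x y"
  by (auto simp: adjoin_null_def dest: closed intro!: bexI[of _ 0])

lemma adjoin_null_null: "c \<in> R \<Longrightarrow> adjoin_null c c 0"
  by (auto simp: adjoin_null_def intro!: bexI[of _ 1])

text \<open>
  This is in general larger than the preorder generated by \<open>a \<preceq> b\<close>. Over a totally ordered
  cancellative quotient, multiplying \<open>x \<preceq> y\<close> by \<open>b ^ n\<close> and relaxing the right-hand factor to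
  \<open>(a + b) ^ n\<close> changes nothing when \<open>a \<preceq> b\<close>; the relaxed factor allows the generator itself, since
  \<open>b * a \<preceq> (a + b) * b\<close>.
\<close>
definition adjoin_le :: "'a \<Rightarrow> 'a \<Rightarrow> 'a \<Rightarrow> 'a \<Rightarrow> bool" where
  "adjoin_le a b x y \<longleftrightarrow> x \<in> R \<and> y \<in> R \<and> (\<exists>n. b ^ n * x \<preceq> (a + b) ^ n * y)"

lemma adjoin_le_exponent_mono:
  assumes "a \<in> R" "b \<in> R" "b ^ n * x \<preceq> (a + b) ^ n * y" "n \<le> m"
  shows "b ^ m * x \<preceq> (a + b) ^ m * y"
proof -
  have "b ^ (m - n) \<preceq> (a + b) ^ (m - n)"
    using assms by (intro power_mono le_add_left)
  then have "b ^ (m - n) * (b ^ n * x) \<preceq> (a + b) ^ (m - n) * ((a + b) ^ n * y)"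
    using assms(3) by (rule mult_mono)
  moreover have "c ^ (m - n) * (c ^ n * z) = c ^ m * z" for c z :: 'a
    using \<open>n \<le> m\<close> by (simp add: mult.assoc[symmetric] power_add[symmetric])
  ultimately show ?thesis by simp
qed

lemma adjoin_le_preorder:
  assumes ab: "a \<in> R" "b \<in> R" shows "semiring_preorder R (adjoin_le a b)"
proof
  show "adjoin_le a b x (x + y)" if "x \<in> R" "y \<in> R" for x y
    using that by (auto simp: adjoin_le_def intro!: exI[of _ 0] le_add_right)
next
  fix x y z assume "adjoin_le a b x y" "adjoin_le a b y z"
  then obtain n m where R: "x \<in> R" "y \<in> R" "z \<in> R"
    and n: "b ^ n * x \<preceq> (a + b) ^ n * y" and m: "b ^ m * y \<preceq> (a + b) ^ m * z"
    by (auto simp: adjoin_le_def)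
  have "b ^ (m + n) * x = b ^ m * (b ^ n * x)" by (simp add: power_add mult.assoc)
  also have "\<dots> \<preceq> b ^ m * ((a + b) ^ n * y)" using n ab by (intro mult_left_mono) auto
  also have "\<dots> = (a + b) ^ n * (b ^ m * y)" by (simp add: ac_simps)
  also have "\<dots> \<preceq> (a + b) ^ n * ((a + b) ^ m * z)" using m ab by (intro mult_left_mono) auto
  also have "\<dots> = (a + b) ^ (m + n) * z" by (simp add: power_add ac_simps)
  finally show "adjoin_le a b x z" using R by (auto simp: adjoin_le_def)
next
  fix x y z assume "adjoin_le a b x z" "adjoin_le a b y z"
  then obtain n m where R: "x \<in> R" "y \<in> R" "z \<in> R"
    and "b ^ n * x \<preceq> (a + b) ^ n * z" and "b ^ m * y \<preceq> (a + b) ^ m * z"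
    by (auto simp: adjoin_le_def)
  then have "b ^ max n m * x \<preceq> (a + b) ^ max n m * z" "b ^ max n m * y \<preceq> (a + b) ^ max n m * z"
    using ab by (auto intro: adjoin_le_exponent_mono)
  then have "b ^ max n m * (x + y) \<preceq> (a + b) ^ max n m * z"
    by (simp add: distrib_left add_least)
  then show "adjoin_le a b (x + y) z" using R by (auto simp: adjoin_le_def)
next
  fix x y z assume "adjoin_le a b x y" and z: "z \<in> R"
  then obtain n where R: "x \<in> R" "y \<in> R" and n: "b ^ n * x \<preceq> (a + b) ^ n * y"
    by (auto simp: adjoin_le_def)
  have "b ^ n * (x * z) \<preceq> (a + b) ^ n * (y * z)"
    using mult_right_mono[OF n z] by (simp add: mult.assoc)
  then show "adjoin_le a b (x * z) (y * z)" using R z by (auto simp: adjoin_le_def)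
qed (use ab in \<open>auto simp: adjoin_le_def\<close>)

lemma adjoin_le_extends: "\<forall>x y. x \<preceq> y \<longrightarrow> adjoin_le a b x y"
  by (auto simp: adjoin_le_def dest: closed intro!: exI[of _ 0])

lemma adjoin_le_le: "a \<in> R \<Longrightarrow> b \<in> R \<Longrightarrow> adjoin_le a b a b"
  by (auto simp: adjoin_le_def algebra_simps intro!: exI[of _ 1] le_add_right)

end

section \<open>Maximal separating preorders are total and cancellative\<close>

definition shifted_powers :: "'a::comm_semiring_1 set \<Rightarrow> 'a \<Rightarrow> 'a set" where
  "shifted_powers R s = {s ^ i + h | i h. h \<in> R}"

definition separates :: "'a::comm_semiring_1 set \<Rightarrow> 'a \<Rightarrow> 'a \<Rightarrow> ('a \<Rightarrow> 'a \<Rightarrow> bool) \<Rightarrow> bool" where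
  "separates R f g le \<longleftrightarrow>
     (\<forall>t\<in>shifted_powers R (f + g). \<not> (le (t * f) (t * g) \<and> le (t * g) (t * f)))"

locale maximal_separating = semiring_preorder R le
  for R :: "'a::comm_semiring_1 set" and le (infix "\<preceq>" 50) +
  fixes f g :: 'a
  assumes f [simp]: "f \<in> R" and g [simp]: "g \<in> R"
    and separates: "separates R f g le"
    and maximal: "semiring_preorder R le' \<Longrightarrow> separates R f g le' \<Longrightarrow>
      (\<And>x y. x \<preceq> y \<Longrightarrow> le' x y) \<Longrightarrow> le' x y \<Longrightarrow> x \<preceq> y"
begin

abbreviation T where "T \<equiv> shifted_powers R (f + g)"

lemma T_I: "h \<in> R \<Longrightarrow> (f + g) ^ i + h \<in> T"
  by (auto simp: shifted_powers_def)

lemma T_E: "t \<in> T \<Longrightarrow> (\<And>i h. t = (f + g) ^ i + h \<Longrightarrow> h \<in> R \<Longrightarrow> P) \<Longrightarrow> P"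
  by (auto simp: shifted_powers_def)

lemma T_closed [simp]: "t \<in> T \<Longrightarrow> t \<in> R"
  by (auto simp: shifted_powers_def)

lemma T_one: "1 \<in> T"
  using T_I[of 0 0] by simp

lemma T_base: "f + g \<in> T"
  using T_I[of 0 1] by simp

lemma T_add:
  assumes "t \<in> T" "h \<in> R" shows "t + h \<in> T"
proof -
  obtain i k where "t = (f + g) ^ i + k" "k \<in> R"
    using assms(1) by (rule T_E)
  then show ?thesis using T_I[of "k + h" i] assms by (simp add: add.assoc)
qed

lemma T_mult: assumes "t \<in> T" "u \<in> T" shows "t * u \<in> T"
proof -
  obtain i h where t: "t = (f + g) ^ i + h" "h \<in> R" using assms(1) by (rule T_E)
  obtain j k where u: "u = (f + g) ^ j + k" "k \<in> R" using assms(2) by (rule T_E)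
  have "t * u = (f + g) ^ (i + j) + ((f + g) ^ i * k + h * u)"
    by (simp add: t u algebra_simps power_add)
  moreover have "(f + g) ^ i * k + h * u \<in> R" using t(2) u by simp
  ultimately show ?thesis by (simp add: T_I)
qed

lemma not_equivalent: "t \<in> T \<Longrightarrow> t * f \<preceq> t * g \<Longrightarrow> t * g \<preceq> t * f \<Longrightarrow> False"
  using separates by (auto simp: separates_def)

text \<open>
  The way maximality is used: an enlargement either adds nothing or loses the separation of \<open>f\<close> and \<open>g\<close>.
\<close>
lemma maximal_cases:
  assumes "semiring_preorder R le'" "\<forall>x y. x \<preceq> y \<longrightarrow> le' x y"
  obtains "\<forall>x y. le' x y \<longrightarrow> x \<preceq> y" | t where "t \<in> T" "le' (t * f) (t * g)" "le' (t * g) (t * f)"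
  using assms maximal unfolding separates_def by metis

lemma T_cancel:
  assumes "t \<in> T" "x \<in> R" "y \<in> R" "t * x \<preceq> t * y" shows "x \<preceq> y"
proof -
  have t: "t \<in> R" using assms by simp
  show ?thesis
  proof (cases rule: maximal_cases[OF colon_preorder[OF t] colon_extends[OF t]])
    case 1
    then show ?thesis using assms by (auto simp: colon_def)
  next
    case (2 u)
    then show ?thesis
      using not_equivalent[of "t * u"] T_mult[of t u] assms by (simp add: colon_def mult.assoc)
  qed
qed

text \<open>
  Force \<open>c \<preceq> 0\<close>. If this loses the separation, then \<open>u = t * f\<close> and \<open>v = t * g\<close> agree up to adding some
  multiple \<open>w\<close> of \<open>c\<close>, while \<open>w * u\<close> and \<open>w * v\<close> are equivalent by assumption. Whether or not \<open>w\<close>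
  vanishes, \<open>u\<close> and \<open>v\<close> ought to be the same, and indeed \<open>(u + v + w) * u\<close> and \<open>(u + v + w) * v\<close> are
  equivalent. The factor \<open>u + v + w = t * (f + g) + w\<close> lies in \<open>T\<close>, which contradicts the separation
  before the enlargement.
\<close>
lemma null_if_equalizes:
  assumes c: "c \<in> R" and eq: "c * f \<preceq> c * g" "c * g \<preceq> c * f"
  shows "c \<preceq> 0"
proof (cases rule: maximal_cases[OF adjoin_null_preorder[OF c] adjoin_null_extends[OF c]])
  case 1
  then show ?thesis using adjoin_null_null[OF c] by auto
next
  case (2 t)
  then have t: "t \<in> T" "t \<in> R" by auto
  obtain d e where d: "d \<in> R" "t * f \<preceq> t * g + c * d" and e: "e \<in> R" "t * g \<preceq> t * f + c * e"
    using 2 by (auto simp: adjoin_null_def)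
  define w where "w = c * (d + e)"
  have w: "w \<in> R" using c d e by (simp add: w_def)
  have "c * d \<preceq> w" "c * e \<preceq> w"
    using c d e by (auto simp: w_def intro!: mult_left_mono le_add_left le_add_right)
  then have le: "t * f \<preceq> t * g + w" "t * g \<preceq> t * f + w"
    using trans[OF d(2) add_mono] trans[OF e(2) add_mono] t by auto
  have wc: "w * (t * p) = ((d + e) * t) * (c * p)" for p
    by (simp add: w_def ac_simps)
  have weq: "w * (t * f) \<preceq> w * (t * g)" "w * (t * g) \<preceq> w * (t * f)"
    unfolding wc using eq d e t by (auto intro!: mult_left_mono)
  have key: "(u + v + w) * u \<preceq> (u + v + w) * v"
    if uv: "u \<in> R" "v \<in> R" "u \<preceq> v + w" "w * u \<preceq> w * v" for u v
  proof -
    have wv: "w * v \<preceq> (u + v + w) * v"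
      using uv w by (intro mult_right_mono le_add_left) auto
    have "(u + v) * u \<preceq> (u + v) * (v + w)"
      using uv by (intro mult_left_mono) auto
    also have "\<dots> = (u + v) * v + w * v + w * u" by (simp add: algebra_simps)
    also have "\<dots> \<preceq> (u + v + w) * v"
      using mult_right_mono[OF le_add_right[of "u + v" w] uv(2)] uv w trans[OF uv(4) wv] wv
      by (auto intro: add_least)
    finally have "(u + v) * u \<preceq> (u + v + w) * v" .
    moreover have "w * u \<preceq> (u + v + w) * v" using uv(4) wv by (rule trans)
    ultimately show ?thesis using add_least by (simp add: distrib_right)
  qed
  define z where "z = (t * f + t * g + w) * t"
  have "z \<in> T"
    using T_mult[OF T_add[OF T_mult[OF t(1) T_base] w] t(1)] by (simp add: z_def distrib_left)
  moreover have "z * f \<preceq> z * g" "z * g \<preceq> z * f"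
    using key[of "t * f" "t * g"] key[of "t * g" "t * f"] le weq t
    by (simp_all add: z_def mult.assoc add.commute)
  ultimately show ?thesis by (blast dest: not_equivalent)
qed

text \<open>
  Force \<open>c \<preceq> 0\<close> again. If \<open>t * f\<close> and \<open>t * g\<close> then agree up to multiples of \<open>c\<close>, multiplying by \<open>c\<close>
  turns these multiples into null elements, so \<open>c\<close> equalizes \<open>f\<close> and \<open>g\<close>.
\<close>
lemma null_if_square_null:
  assumes c: "c \<in> R" and sq: "c * c \<preceq> 0"
  shows "c \<preceq> 0"
proof (cases rule: maximal_cases[OF adjoin_null_preorder[OF c] adjoin_null_extends[OF c]])
  case 1
  then show ?thesis using adjoin_null_null[OF c] by auto
next
  case (2 t)
  then have t: "t \<in> T" "t \<in> R" by auto
  have step: "c * p \<preceq> c * q" if pq: "p \<in> R" "q \<in> R" "adjoin_null c (t * p) (t * q)" for p q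
  proof -
    obtain d where d: "d \<in> R" "t * p \<preceq> t * q + c * d"
      using pq by (auto simp: adjoin_null_def)
    have "t * (c * p) = c * (t * p)" by (simp add: ac_simps)
    also have "\<dots> \<preceq> c * (t * q + c * d)" using c d by (intro mult_left_mono) auto
    also have "\<dots> = t * (c * q) + d * (c * c)" by (simp add: algebra_simps)
    also have "\<dots> \<preceq> t * (c * q) + d * 0"
      using c d sq t pq by (intro add_mono mult_left_mono) auto
    finally have "t * (c * p) \<preceq> t * (c * q)" by simp
    then show ?thesis using T_cancel[OF t(1)] c pq by auto
  qed
  show ?thesis using 2 by (intro null_if_equalizes step c) auto
qed

lemma null_if_power_null: "c \<in> R \<Longrightarrow> c ^ Suc k \<preceq> 0 \<Longrightarrow> c \<preceq> 0"
proof (induction k)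
  case (Suc k)
  \<comment> \<open>The square of \<open>c ^ Suc k\<close> is a multiple of the null element \<open>c ^ Suc (Suc k)\<close>.\<close>
  have "c ^ Suc k * c ^ Suc k = c ^ k * c ^ Suc (Suc k)"
    by (simp add: ac_simps)
  also have "\<dots> \<preceq> c ^ k * 0"
    using Suc.prems by (intro mult_left_mono) auto
  finally show ?case using Suc null_if_square_null[of "c ^ Suc k"] by simp
qed simp

text \<open>If making \<open>c\<close> cancellable loses the separation, then \<open>c\<close> itself equalizes \<open>f\<close> and \<open>g\<close>.\<close>
lemma cancel:
  assumes "c \<in> R" "x \<in> R" "y \<in> R" "c * x \<preceq> c * y" shows "c \<preceq> 0 \<or> x \<preceq> y"
proof (cases rule: maximal_cases[OF colon_preorder[OF assms(1)] colon_extends[OF assms(1)]])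
  case 1
  then show ?thesis using assms by (auto simp: colon_def)
next
  case (2 t)
  have comm: "c * (t * p) = t * (c * p)" for p by (simp add: ac_simps)
  have "c * f \<preceq> c * g" "c * g \<preceq> c * f"
    using 2 T_cancel[OF 2(1)] assms by (auto simp: colon_def comm)
  then show ?thesis using null_if_equalizes assms by blast
qed

text \<open>
  If neither \<open>a \<preceq> b\<close> nor \<open>b \<preceq> a\<close> holds, forcing either of them loses the separation. The two resulting
  relations between \<open>f\<close> and \<open>g\<close> combine to show that a power of \<open>a + b\<close> equalizes \<open>f\<close> and \<open>g\<close>. Then
  \<open>a + b\<close> is null, and so are \<open>a\<close> and \<open>b\<close>, which makes them comparable after all.
\<close>
lemma total:
  assumes ab: "a \<in> R" "b \<in> R" shows "a \<preceq> b \<or> b \<preceq> a"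
proof (rule ccontr)
  assume no: "\<not> ?thesis"
  let ?s = "a + b"
  \<comment> \<open>Here \<open>x\<close> and \<open>y\<close> are \<open>a\<close> and \<open>b\<close> in either order; one exponent serves both directions.\<close>
  have step: "\<exists>t n. t \<in> T \<and> y ^ n * (t * f) \<preceq> ?s ^ n * (t * g) \<and> y ^ n * (t * g) \<preceq> ?s ^ n * (t * f)"
    if xy: "x \<in> R" "y \<in> R" "x + y = ?s" "\<not> x \<preceq> y" for x y
  proof (cases rule: maximal_cases[OF adjoin_le_preorder[OF xy(1,2)] adjoin_le_extends])
    case 1
    then show ?thesis using adjoin_le_le[OF xy(1,2)] xy(4) by auto
  next
    case (2 t)
    then obtain n m where nm: "y ^ n * (t * f) \<preceq> (x + y) ^ n * (t * g)"
        "y ^ m * (t * g) \<preceq> (x + y) ^ m * (t * f)"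
      by (auto simp: adjoin_le_def)
    have "y ^ max n m * (t * f) \<preceq> (x + y) ^ max n m * (t * g)"
        "y ^ max n m * (t * g) \<preceq> (x + y) ^ max n m * (t * f)"
      using adjoin_le_exponent_mono[OF xy(1,2) nm(1), of "max n m"]
        adjoin_le_exponent_mono[OF xy(1,2) nm(2), of "max n m"] by auto
    then show ?thesis using 2(1) unfolding xy(3) by blast
  qed
  obtain t n where t: "t \<in> T" "b ^ n * (t * f) \<preceq> ?s ^ n * (t * g)" "b ^ n * (t * g) \<preceq> ?s ^ n * (t * f)"
    using step[of a b] ab no by auto
  obtain u m where u: "u \<in> T" "a ^ m * (u * f) \<preceq> ?s ^ m * (u * g)" "a ^ m * (u * g) \<preceq> ?s ^ m * (u * f)"
    using step[of b a] ab no by (auto simp: add.commute)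
  let ?k = "m + n"
  have combine: "?s ^ ?k * p \<preceq> ?s ^ ?k * q"
    if pq: "p \<in> R" "q \<in> R" and tb: "b ^ n * (t * p) \<preceq> ?s ^ n * (t * q)"
      and ua: "a ^ m * (u * p) \<preceq> ?s ^ m * (u * q)" for p q
  proof -
    have tu: "t \<in> R" "u \<in> R" using t u by auto
    have "(t * u) * (?s ^ ?k * p) = ?s ^ ?k * (t * u * p)" by (simp add: ac_simps)
    also have "\<dots> \<preceq> (?s ^ n * a ^ m + ?s ^ m * b ^ n) * (t * u * p)"
      using ab tu pq by (intro mult_right_mono power_add_le) auto
    also have "\<dots> = (t * ?s ^ n) * (a ^ m * (u * p)) + (u * ?s ^ m) * (b ^ n * (t * p))"
      by (simp add: algebra_simps)
    also have "\<dots> \<preceq> (t * ?s ^ n) * (?s ^ m * (u * q)) + (u * ?s ^ m) * (?s ^ n * (t * q))"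
      using ab tu pq tb ua by (intro add_mono mult_left_mono) auto
    also have "(t * ?s ^ n) * (?s ^ m * (u * q)) = (t * u) * (?s ^ ?k * q)"
      by (simp add: power_add ac_simps)
    also have "(u * ?s ^ m) * (?s ^ n * (t * q)) = (t * u) * (?s ^ ?k * q)"
      by (simp add: power_add ac_simps)
    also have "(t * u) * (?s ^ ?k * q) + (t * u) * (?s ^ ?k * q) \<preceq> (t * u) * (?s ^ ?k * q)"
      using ab tu pq by (intro add_least) auto
    finally show ?thesis
      using T_cancel[OF T_mult[OF t(1) u(1)]] ab pq by auto
  qed
  have "?s ^ ?k \<preceq> 0"
    using ab t u by (intro null_if_equalizes combine) auto
  then have "?s ^ Suc ?k \<preceq> 0"
    using mult_left_mono[of "?s ^ ?k" 0 ?s] ab by simp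
  then have "?s \<preceq> 0" using null_if_power_null[of ?s ?k] ab by simp
  then have "a \<preceq> b"
    using ab by (meson le_add_right trans zero_least)
  then show False using no by simp
qed

lemma not_equivalent_base: "f \<preceq> g \<Longrightarrow> g \<preceq> f \<Longrightarrow> False"
  using not_equivalent[OF T_one] by simp

end

text \<open>
  Preorders form a chain-complete family, and a union of a chain keeps \<open>f\<close> and \<open>g\<close> separated because
  a failure of separation is witnessed by two pairs, which lie in one member of the chain.
\<close>
lemma (in semiring_preorder) exists_maximal_separating:
  assumes fg: "f \<in> R" "g \<in> R" "separates R f g le"
  shows "\<exists>le'. (\<forall>x y. x \<preceq> y \<longrightarrow> le' x y) \<and> maximal_separating R le' f g"
proof -
  define rel where "rel L x y \<longleftrightarrow> (x, y) \<in> L" for L and x y :: 'a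
  have rel_Collect: "rel {(x, y). P x y} = P" for P by (simp add: rel_def fun_eq_iff)
  let ?A = "{L. {(x, y). x \<preceq> y} \<subseteq> L \<and> semiring_preorder R (rel L) \<and> separates R f g (rel L)}"
  have "\<exists>L\<in>?A. \<forall>X\<in>?A. L \<subseteq> X \<longrightarrow> X = L"
  proof (rule subset_Zorn_nonempty)
    have "{(x, y). x \<preceq> y} \<in> ?A" using fg semiring_preorder_axioms by (simp add: rel_Collect)
    then show "?A \<noteq> {}" by blast
  next
    fix C assume C: "C \<noteq> {}" "subset.chain ?A C"
    have in_A: "X \<in> ?A" if "X \<in> C" for X using C that by (auto simp: subset.chain_def)
    have common: "\<exists>X\<in>C. rel X x y \<and> rel X x' y'" if "rel (\<Union>C) x y" "rel (\<Union>C) x' y'" for x y x' y'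
    proof -
      from that obtain X Y where "X \<in> C" "Y \<in> C" "(x, y) \<in> X" "(x', y') \<in> Y"
        by (auto simp: rel_def)
      moreover from this C(2) have "X \<subseteq> Y \<or> Y \<subseteq> X" by (auto simp: subset_chain_def)
      ultimately show ?thesis by (auto simp: rel_def)
    qed
    have up: "rel (\<Union>C) x y" if "X \<in> C" "rel X x y" for X x y using that by (auto simp: rel_def)
    have pre: "semiring_preorder R (rel X)" if "X \<in> C" for X using in_A[OF that] by simp
    obtain X0 where X0: "X0 \<in> C" using C by auto
    have "semiring_preorder R (rel (\<Union>C))"
    proof
      show "a \<in> R \<and> b \<in> R" if "rel (\<Union>C) a b" for a b
        using common[OF that that] semiring_preorder.closed[OF pre] by metis
      show "rel (\<Union>C) a (a + b)" if "a \<in> R" "b \<in> R" for a b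
        using semiring_preorder.le_add_right[OF pre[OF X0] that] X0 by (rule up[rotated])
      show "rel (\<Union>C) a c" if "rel (\<Union>C) a b" "rel (\<Union>C) b c" for a b c
        using common[OF that] semiring_preorder.trans[OF pre] up by metis
      show "rel (\<Union>C) (a + b) c" if "rel (\<Union>C) a c" "rel (\<Union>C) b c" for a b c
        using common[OF that] semiring_preorder.add_least[OF pre] up by metis
      show "rel (\<Union>C) (a * c) (b * c)" if "rel (\<Union>C) a b" "c \<in> R" for a b c
        using common[OF that(1,1)] that(2) semiring_preorder.mult_right_mono[OF pre] up by metis
    qed auto
    moreover have "separates R f g (rel (\<Union>C))"
      unfolding separates_def
    proof (intro ballI notI)
      fix t assume t: "t \<in> shifted_powers R (f + g)"
        "rel (\<Union>C) (t * f) (t * g) \<and> rel (\<Union>C) (t * g) (t * f)"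
      then obtain X where "X \<in> C" "rel X (t * f) (t * g)" "rel X (t * g) (t * f)"
        using common by metis
      then show False using in_A[of X] t(1) by (auto simp: separates_def)
    qed
    moreover have "{(x, y). x \<preceq> y} \<subseteq> \<Union>C" using X0 in_A by blast
    ultimately show "\<Union>C \<in> ?A" by simp
  qed
  then obtain L where L: "L \<in> ?A" "\<forall>X\<in>?A. L \<subseteq> X \<longrightarrow> X = L" by (rule bexE)
  have "maximal_separating R (rel L) f g"
  proof (intro maximal_separating.intro maximal_separating_axioms.intro)
    fix le' x y
    assume le': "semiring_preorder R le'" "separates R f g le'" "\<And>x y. rel L x y \<Longrightarrow> le' x y"
      and xy: "le' x y"
    have "L \<subseteq> {(x, y). le' x y}" using le'(3) by (auto simp: rel_def)
    moreover from this have "{(x, y). le' x y} \<in> ?A" using le'(1,2) L(1) by (auto simp: rel_Collect)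
    ultimately have "{(x, y). le' x y} = L" by (rule L(2)[THEN bspec, THEN mp, rotated])
    then show "rel L x y" using xy by (auto simp: rel_def)
  qed (use L(1) fg in auto)
  moreover have "\<forall>x y. x \<preceq> y \<longrightarrow> rel L x y" using L(1) by (auto simp: rel_def)
  ultimately show ?thesis by blast
qed

lemma congruence_preorder:
  fixes R :: "'a::comm_semiring_1 set"
  assumes R: "0 \<in> R" "1 \<in> R"
    and cl: "\<And>a b. a \<in> R \<Longrightarrow> b \<in> R \<Longrightarrow> a + b \<in> R" "\<And>a b. a \<in> R \<Longrightarrow> b \<in> R \<Longrightarrow> a * b \<in> R"
    and idem: "\<And>a. a \<in> R \<Longrightarrow> a + a = a"
    and E: "congruence R E"
  shows "semiring_preorder R (\<lambda>a b. (a + b, b) \<in> E \<and> a \<in> R \<and> b \<in> R)"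
proof -
  have refl: "(a, a) \<in> E" if "a \<in> R" for a
    using E that by (auto simp: congruence_def equiv_def refl_on_def)
  have sym: "(b, a) \<in> E" if "(a, b) \<in> E" for a b
    using E that by (auto simp: congruence_def equiv_def dest: symD)
  have trans: "(a, c) \<in> E" if "(a, b) \<in> E" "(b, c) \<in> E" for a b c
    using E that unfolding congruence_def equiv_def by (meson transD)
  have add: "(a + c, b + d) \<in> E" and mult: "(a * c, b * d) \<in> E"
    if "(a, b) \<in> E" "(c, d) \<in> E" for a b c d
    using E that unfolding congruence_def by blast+
  show ?thesis
  proof
    fix a b assume "a \<in> R" "b \<in> R"
    then show "(a + (a + b), a + b) \<in> E \<and> a \<in> R \<and> a + b \<in> R"
      using idem[of a] cl refl[of "a + b"] by (simp flip: add.assoc)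
  next
    fix a b c
    assume "(a + b, b) \<in> E \<and> a \<in> R \<and> b \<in> R" "(b + c, c) \<in> E \<and> b \<in> R \<and> c \<in> R"
    then have R: "a \<in> R" "b \<in> R" "c \<in> R" and ab: "(a + b, b) \<in> E" and bc: "(b + c, c) \<in> E" by auto
    have "(a + c, a + (b + c)) \<in> E" using add[OF refl[OF R(1)] sym[OF bc]] .
    moreover have "(a + (b + c), b + c) \<in> E" using add[OF ab refl[OF R(3)]] by (simp add: add.assoc)
    ultimately have "(a + c, c) \<in> E" using bc trans by blast
    then show "(a + c, c) \<in> E \<and> a \<in> R \<and> c \<in> R" using R by simp
  next
    fix a b c
    assume "(a + c, c) \<in> E \<and> a \<in> R \<and> c \<in> R" "(b + c, c) \<in> E \<and> b \<in> R \<and> c \<in> R"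
    then have R: "a \<in> R" "b \<in> R" "c \<in> R" and ac: "(a + c, c) \<in> E" and bc: "(b + c, c) \<in> E" by auto
    have "(a + b + c, a + c) \<in> E" using add[OF refl[OF R(1)] bc] by (simp add: add.assoc)
    then show "(a + b + c, c) \<in> E \<and> a + b \<in> R \<and> c \<in> R" using R cl trans[OF _ ac] by simp
  next
    fix a b c
    assume "(a + b, b) \<in> E \<and> a \<in> R \<and> b \<in> R" "c \<in> R"
    then show "(a * c + b * c, b * c) \<in> E \<and> a * c \<in> R \<and> b * c \<in> R"
      using mult[of "a + b" b c c] refl[of c] cl by (simp add: distrib_right)
  qed (use R cl in auto)
qed

section \<open>Systems of weak and strict linear inequalities\<close>

text \<open>
  A flag distinguishes strict from weak inequalities, so that the sum of two inequalities carries
  the disjunction of their flags.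
\<close>
definition negative :: "bool \<Rightarrow> real \<Rightarrow> bool" where
  "negative strict y \<longleftrightarrow> (if strict then y < 0 else y \<le> 0)"

lemma negative_scale: "k > 0 \<Longrightarrow> negative s (k * y) \<longleftrightarrow> negative s y"
  by (auto simp: negative_def mult_less_0_iff mult_le_0_iff)

text \<open>
  Finitely many lower bounds \<open>A\<close> and upper bounds \<open>B\<close>, some of them strict, admit a common solution
  when they do so in pairs: the midpoint of the largest lower and the smallest upper bound.
\<close>
lemma separating_point:
  fixes A B :: "(bool \<times> real) set"
  assumes fin: "finite A" "finite B"
    and sep: "\<And>s a s' b. (s, a) \<in> A \<Longrightarrow> (s', b) \<in> B \<Longrightarrow> negative (s \<or> s') (a - b)"
  shows "\<exists>x. (\<forall>(s, a)\<in>A. negative s (a - x)) \<and> (\<forall>(s, b)\<in>B. negative s (x - b))"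
proof -
  define l u where "l = Max (snd ` A)" and "u = Min (snd ` B)"
  have l: "l \<in> snd ` A" "a \<le> l" if "(s, a) \<in> A" for s a
    using that fin by (force simp: l_def intro!: Max_in Max_ge)+
  have u: "u \<in> snd ` B" "u \<le> b" if "(s, b) \<in> B" for s b
    using that fin by (force simp: u_def intro!: Min_in Min_le)+
  consider "A = {}" | "B = {}" | "A \<noteq> {}" "B \<noteq> {}" by blast
  then show ?thesis
  proof cases
    case 1
    have "negative s (u - 1 - b)" if "(s, b) \<in> B" for s b
      using u[OF that] by (auto simp: negative_def)
    then show ?thesis using 1 by auto
  next
    case 2
    have "negative s (a - (l + 1))" if "(s, a) \<in> A" for s a
      using l[OF that] by (auto simp: negative_def)
    then show ?thesis using 2 by (intro exI[of _ "l + 1"]) auto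
  next
    case 3
    then obtain s s' where lu: "(s, l) \<in> A" "(s', u) \<in> B"
      using l(1) u(1) by fastforce
    have "l \<le> u" using sep[OF lu] by (auto simp: negative_def split: if_splits)
    have 1: "negative t (a - (l + u) / 2)" if "(t, a) \<in> A" for t a
      using l(2)[OF that] sep[OF that lu(2)] \<open>l \<le> u\<close> by (auto simp: negative_def split: if_splits)
    have 2: "negative t ((l + u) / 2 - b)" if "(t, b) \<in> B" for t b
      using u(2)[OF that] sep[OF lu(1) that] \<open>l \<le> u\<close> by (auto simp: negative_def split: if_splits)
    show ?thesis using 1 2 by (intro exI[of _ "(l + u) / 2"]) auto
  qed
qed

text \<open>
  \<open>K s \<alpha> v\<close> reads as the homogeneous inequality \<open>r * \<alpha> + \<Sum> c b * v b \<le> 0\<close>, strict if \<open>s\<close>, in the unknowns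
  \<open>r\<close> and \<open>c\<close>. The whole of \<open>K\<close> may have no solution, for instance when it describes a lexicographic
  order, but every finite part has one as soon as \<open>K\<close> is closed under addition and contains no
  strict inequality \<open>r * \<alpha> < 0\<close> with \<open>\<alpha> \<ge> 0\<close>. The coordinate \<open>b\<close> is eliminated by adding positive integer
  multiples of an inequality with \<open>v b > 0\<close> and one with \<open>w b < 0\<close>; the sum is again in \<open>K\<close>, as
  integer multiples are repeated sums.
\<close>
lemma fourier_motzkin:
  fixes K :: "bool \<Rightarrow> real \<Rightarrow> ('b \<Rightarrow> int) \<Rightarrow> bool"
  assumes "finite I"
    and "\<And>s s' \<alpha> \<beta> v w. K s \<alpha> v \<Longrightarrow> K s' \<beta> w \<Longrightarrow> K (s \<or> s') (\<alpha> + \<beta>) (\<lambda>b. v b + w b)"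
    and "\<And>\<alpha> v. K True \<alpha> v \<Longrightarrow> \<forall>b\<in>I. v b = 0 \<Longrightarrow> \<alpha> < 0"
    and "finite C" and "\<And>s \<alpha> v. (s, \<alpha>, v) \<in> C \<Longrightarrow> K s \<alpha> v"
  shows "\<exists>r\<ge>0. \<exists>c. \<forall>(s, \<alpha>, v)\<in>C. negative s (r * \<alpha> + (\<Sum>b\<in>I. c b * of_int (v b)))"
  using assms
proof (induction I arbitrary: K C rule: finite_induct)
  case empty
  have multiple: "K s (of_nat (Suc n) * \<alpha>) (\<lambda>b. of_nat (Suc n) * v b)" if "K s \<alpha> v" for s \<alpha> v n
  proof (induction n)
    case (Suc n)
    then show ?case using empty(1)[OF that Suc] by (simp add: algebra_simps)
  qed (use that in simp)
  \<comment> \<open>Only \<open>r\<close> is left: take \<open>r = 1\<close>, unless some inequality demands \<open>r \<le> 0\<close>; then take \<open>r = 0\<close>.\<close>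
  show ?case
  proof (cases "\<exists>(s, \<alpha>, v)\<in>C. \<alpha> > 0")
    case False
    have "negative s \<alpha>" if "(s, \<alpha>, v) \<in> C" for s \<alpha> v
      using that False empty(4)[OF that] empty(2)[of \<alpha> v] by (cases s) (auto simp: negative_def)
    then show ?thesis by (intro exI[of _ 1]) auto
  next
    case True
    then obtain s \<beta> w where "(s, \<beta>, w) \<in> C" "\<beta> > 0" by auto
    then have w: "K s \<beta> w" "\<beta> > 0" using empty(4) by auto
    \<comment> \<open>Enough multiples of \<open>\<beta>\<close> added to a strict inequality would make its constant positive.\<close>
    have "\<not> s" if "(s, \<alpha>, v) \<in> C" for s \<alpha> v
    proof
      assume s
      obtain n where "- \<alpha> < of_nat n * \<beta>" using w(2) reals_Archimedean3 by blast
      then have "0 < \<alpha> + of_nat (Suc n) * \<beta>" using w(2) by (simp add: algebra_simps)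
      moreover have "K True (\<alpha> + of_nat (Suc n) * \<beta>) (\<lambda>b. v b + of_nat (Suc n) * w b)"
        using empty(1)[OF empty(4)[OF that] multiple[OF w(1)], of n] \<open>s\<close> by simp
      ultimately show False using empty(2) by fastforce
    qed
    then have "negative s (0 * \<alpha>)" if "(s, \<alpha>, v) \<in> C" for s \<alpha> v
      using that by (auto simp: negative_def)
    then show ?thesis by (intro exI[of _ 0]) auto
  qed
next
  case (insert b I)
  note add = insert.prems(1)
  have multiple: "K s (of_int k * \<alpha>) (\<lambda>i. k * v i)" if "K s \<alpha> v" "k > 0" for s \<alpha> v k
    using that(2)
  proof (induction k rule: int_gr_induct)
    case (step k)
    then show ?case using add[OF that(1) step(2)] by (simp add: algebra_simps)
  qed (use that in simp)
  define mix where "mix = (\<lambda>(s, \<alpha> :: real, v) (s', \<beta>, w).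
    (s \<or> s', of_int (- w b) * \<alpha> + of_int (v b) * \<beta>, \<lambda>i. (- w b) * v i + v b * w i))"
  let ?P = "{(s, \<alpha>, v) \<in> C. v b > 0}" and ?N = "{(s, \<alpha>, v) \<in> C. v b < 0}"
    and ?Z = "{(s, \<alpha>, v) \<in> C. v b = 0}"
  let ?D = "?Z \<union> (\<lambda>(p, q). mix p q) ` (?P \<times> ?N)"
  let ?K = "\<lambda>s \<alpha> v. K s \<alpha> v \<and> v b = 0"
  have mixK: "?K s'' \<gamma> u"
    if "mix (s, \<alpha>, v) (s', \<beta>, w) = (s'', \<gamma>, u)" "(s, \<alpha>, v) \<in> ?P" "(s', \<beta>, w) \<in> ?N"
    for s'' \<gamma> u s \<alpha> v s' \<beta> w
    using add[OF multiple[of s \<alpha> v "- w b"] multiple[of s' \<beta> w "v b"]] that insert.prems(4)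
    by (auto simp: mix_def)
  have "\<exists>r\<ge>0. \<exists>c. \<forall>(s, \<alpha>, v)\<in>?D. negative s (r * \<alpha> + (\<Sum>b\<in>I. c b * of_int (v b)))"
  proof (rule insert.IH[of ?K])
    show "?K (s \<or> s') (\<alpha> + \<beta>) (\<lambda>b. v b + w b)" if "?K s \<alpha> v" "?K s' \<beta> w" for s s' \<alpha> \<beta> v w
      using that add by simp
    show "\<alpha> < 0" if "?K True \<alpha> v" "\<forall>b\<in>I. v b = 0" for \<alpha> v
      using that insert.prems(2)[of \<alpha> v] by simp
    show "finite ?D" using insert.prems(3) by (auto intro: finite_subset)
    show "?K s \<alpha> v" if "(s, \<alpha>, v) \<in> ?D" for s \<alpha> v
      using that
    proof
      assume "(s, \<alpha>, v) \<in> ?Z" then show ?thesis using insert.prems(4) by auto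
    next
      assume "(s, \<alpha>, v) \<in> (\<lambda>(p, q). mix p q) ` (?P \<times> ?N)"
      then obtain p q where "p \<in> ?P" "q \<in> ?N" "mix p q = (s, \<alpha>, v)" by auto
      then show ?thesis using mixK by (cases p, cases q) blast
    qed
  qed
  then obtain r c where r: "r \<ge> 0"
    and c: "\<And>s \<alpha> v. (s, \<alpha>, v) \<in> ?D \<Longrightarrow> negative s (r * \<alpha> + (\<Sum>b\<in>I. c b * of_int (v b)))"
    by fastforce
  define val where "val \<alpha> v = r * \<alpha> + (\<Sum>b\<in>I. c b * of_int (v b))" for \<alpha> and v :: "'b \<Rightarrow> int"
  define bound where "bound = (\<lambda>(s::bool, \<alpha>, v). (s, - val \<alpha> v / of_int (v b)))"
  have "\<exists>x. (\<forall>(s, a)\<in>bound ` ?N. negative s (a - x)) \<and> (\<forall>(s, a)\<in>bound ` ?P. negative s (x - a))"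
  proof (rule separating_point)
    show "finite (bound ` ?N)" "finite (bound ` ?P)"
      using insert.prems(3) by (auto intro: finite_subset)
  next
    fix s' y s x assume "(s', y) \<in> bound ` ?N" "(s, x) \<in> bound ` ?P"
    then obtain \<alpha> v \<beta> w where v: "(s, \<alpha>, v) \<in> ?P" and w: "(s', \<beta>, w) \<in> ?N"
      and x: "x = - val \<alpha> v / of_int (v b)" and y: "y = - val \<beta> w / of_int (w b)"
      by (auto simp: bound_def)
    let ?\<gamma> = "of_int (- w b) * \<alpha> + of_int (v b) * \<beta>" and ?u = "\<lambda>i. (- w b) * v i + v b * w i"
    have "mix (s, \<alpha>, v) (s', \<beta>, w) = (s \<or> s', ?\<gamma>, ?u)" by (simp add: mix_def)
    then have "(s \<or> s', ?\<gamma>, ?u) \<in> ?D"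
      using v w by (intro UnI2 image_eqI[of _ _ "((s, \<alpha>, v), (s', \<beta>, w))"]) auto
    then have "negative (s \<or> s') (val ?\<gamma> ?u)" unfolding val_def by (rule c)
    also have "val ?\<gamma> ?u = of_int (- w b) * val \<alpha> v + of_int (v b) * val \<beta> w"
      by (simp add: val_def algebra_simps sum.distrib sum_distrib_left sum_negf sum_subtractf)
    also have "\<dots> = of_int (- w b) * of_int (v b) * (y - x)"
      using v w by (simp add: x y field_simps)
    finally show "negative (s' \<or> s) (y - x)"
      using v w negative_scale[of "of_int (- w b) * of_int (v b)" "s \<or> s'" "y - x"]
      by (simp add: disj_commute mult_neg_pos)
  qed
  then obtain x where "\<forall>(s, a)\<in>bound ` ?N. negative s (a - x)"
    and "\<forall>(s, a)\<in>bound ` ?P. negative s (x - a)" by (elim exE conjE)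
  note x = this[THEN bspec, of "(s, a)" for s a, unfolded prod.case]
  have sum: "(\<Sum>i\<in>insert b I. (c(b := x)) i * of_int (v i)) = x * of_int (v b) + (\<Sum>i\<in>I. c i * of_int (v i))" for v :: "'b \<Rightarrow> int"
    using insert.hyps by (simp add: sum.insert) (intro sum.cong, auto)
  have "negative s (r * \<alpha> + (\<Sum>i\<in>insert b I. (c(b := x)) i * of_int (v i)))" if "(s, \<alpha>, v) \<in> C" for s \<alpha> v
  proof -
    consider "v b = 0" | "v b > 0" | "v b < 0" by linarith
    then show ?thesis unfolding sum
    proof cases
      case 1
      then show "negative s (r * \<alpha> + (x * of_int (v b) + (\<Sum>i\<in>I. c i * of_int (v i))))"
        using that c[of s \<alpha> v] by simp
    next
      case 2
      then have "negative s (x - (- val \<alpha> v / of_int (v b)))"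
        using that by (intro x(2)) (force simp: bound_def)
      then show "negative s (r * \<alpha> + (x * of_int (v b) + (\<Sum>i\<in>I. c i * of_int (v i))))"
        using 2 by (auto simp: negative_def val_def field_simps split: if_splits)
    next
      case 3
      then have "negative s (- val \<alpha> v / of_int (v b) - x)"
        using that by (intro x(1)) (force simp: bound_def)
      then show "negative s (r * \<alpha> + (x * of_int (v b) + (\<Sum>i\<in>I. c i * of_int (v i))))"
        using 3 by (auto simp: negative_def val_def field_simps split: if_splits)
    qed
  qed
  then show ?case using r by blast
qed

section \<open>Monoid semirings over tropical coefficients\<close>

lemma free_coordinates:
  assumes "fg_free TYPE('m::ab_group_add)"
  obtains B :: "'m::ab_group_add set" and \<phi> :: "'m::ab_group_add \<Rightarrow> 'm \<Rightarrow> int"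
  where "finite B" and "\<forall>u v b. \<phi> (u + v) b = \<phi> u b + \<phi> v b"
    and "\<forall>u v. (\<forall>b\<in>B. \<phi> u b = \<phi> v b) \<longrightarrow> u = v"
proof -
  interpret module "zscale :: int \<Rightarrow> 'm \<Rightarrow> 'm" by (rule module_zscale)
  obtain B :: "'m set" where B: "finite B" "\<not> dependent B" "span B = UNIV"
    using assms by (auto simp: fg_free_def)
  have "u = (\<Sum>b\<in>B. zscale (representation B u b) b)" for u
    using sum_representation_eq[OF B(2) _ B(1), of u] B(3) by simp
  then have "u = v" if "\<forall>b\<in>B. representation B u b = representation B v b" for u v
    using that by (metis (no_types, lifting) sum.cong)
  moreover have "representation B (u + v) b = representation B u b + representation B v b" for u v b
    using representation_add[OF B(2)] B(3) by simp
  ultimately show ?thesis using that B(1) by blast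
qed

text \<open>The value 0 at the zero of the semifield is a dummy; \<open>tlog\<close> is used on nonzero elements only.\<close>
definition tlog :: "trop \<Rightarrow> real" where
  "tlog a = real_of_ereal (trop_log a)"

lemma trop_log_nonzero: "a \<noteq> 0 \<Longrightarrow> trop_log a = ereal (tlog a)"
proof -
  assume a: "a \<noteq> 0"
  have "trop_log a \<noteq> - \<infinity>" using a by (metis trop_log_inject zero_trop.rep_eq)
  moreover have "trop_log a \<noteq> \<infinity>" using trop_log by blast
  ultimately show ?thesis by (cases "trop_log a") (auto simp: tlog_def)
qed

lemma trop_mult_nonzero: "a \<noteq> 0 \<Longrightarrow> b \<noteq> 0 \<Longrightarrow> a * b \<noteq> (0::trop)"
  by (metis times_trop.rep_eq trop_log_nonzero MInfty_neq_ereal(2) plus_ereal.simps(1) zero_trop.rep_eq)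

lemma tlog_mult: "a \<noteq> 0 \<Longrightarrow> b \<noteq> 0 \<Longrightarrow> tlog (a * b) = tlog a + tlog b"
  using trop_log_nonzero[of a] trop_log_nonzero[of b] by (simp add: tlog_def[of "a * b"] times_trop.rep_eq)

lemma trop_add_absorb: "a \<noteq> 0 \<Longrightarrow> b \<noteq> 0 \<Longrightarrow> tlog a \<le> tlog b \<Longrightarrow> a + b = b"
  by (simp add: plus_trop.rep_eq trop_log_nonzero flip: trop_log_inject)

lemma poly_mapping_trop_idem: "p + p = (p :: 'm \<Rightarrow>\<^sub>0 trop)"
proof -
  have "a + a = a" for a :: trop by transfer simp
  then show ?thesis by (intro poly_mapping_eqI) (simp add: lookup_add)
qed

lemma poly_mapping_sum_terms:
  "p = (\<Sum>u\<in>Poly_Mapping.keys p. Poly_Mapping.single u (Poly_Mapping.lookup p u))"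
  by (intro poly_mapping_eqI)
    (auto simp: lookup_sum lookup_single when_def in_keys_iff sum.delta)

locale submonoid_semiring =
  fixes S :: "trop set" and M :: "'m::ab_group_add set"
  assumes S: "sub_semifield S"
    and M_zero: "0 \<in> M" and M_add: "u \<in> M \<Longrightarrow> v \<in> M \<Longrightarrow> u + v \<in> M"
begin

abbreviation R where "R \<equiv> monoid_semiring S M"

lemma single_closed: "u \<in> M \<Longrightarrow> a \<in> S \<Longrightarrow> Poly_Mapping.single u a \<in> R"
  using S by (auto simp: monoid_semiring_def sub_semifield_def lookup_single when_def)

lemma lookup_in_S: "p \<in> R \<Longrightarrow> Poly_Mapping.lookup p u \<in> S"
  by (simp add: monoid_semiring_def)

lemma keys_in_M: "p \<in> R \<Longrightarrow> u \<in> Poly_Mapping.keys p \<Longrightarrow> u \<in> M"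
  by (auto simp: monoid_semiring_def)

lemma one_S: "1 \<in> S" using S by (simp add: sub_semifield_def)

lemma mult_S: "a \<in> S \<Longrightarrow> b \<in> S \<Longrightarrow> a * b \<in> S" using S by (simp add: sub_semifield_def)

lemma term_in_R:
  "p \<in> R \<Longrightarrow> u \<in> Poly_Mapping.keys p \<Longrightarrow> Poly_Mapping.single u (Poly_Mapping.lookup p u) \<in> R"
  using keys_in_M lookup_in_S single_closed by blast

lemma zero_in_R: "0 \<in> R"
  using S by (auto simp: monoid_semiring_def sub_semifield_def)

lemma one_in_R: "1 \<in> R"
  using single_closed[of 0 1] S M_zero by (simp add: sub_semifield_def)

lemma add_in_R: "p \<in> R \<Longrightarrow> q \<in> R \<Longrightarrow> p + q \<in> R"
  using S keys_add[of p q] by (auto simp: monoid_semiring_def sub_semifield_def lookup_add)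

lemma sum_in_R: "(\<And>i. i \<in> A \<Longrightarrow> p i \<in> R) \<Longrightarrow> sum p A \<in> R"
  by (induction A rule: infinite_finite_induct) (auto intro: zero_in_R add_in_R)

lemma mult_in_R:
  assumes "p \<in> R" "q \<in> R" shows "p * q \<in> R"
proof -
  let ?t = "\<lambda>p u. Poly_Mapping.single u (Poly_Mapping.lookup p u)"
  have "p * q = (\<Sum>u\<in>Poly_Mapping.keys p. ?t p u) * (\<Sum>v\<in>Poly_Mapping.keys q. ?t q v)"
    by (simp flip: poly_mapping_sum_terms)
  also have "\<dots> = (\<Sum>u\<in>Poly_Mapping.keys p. \<Sum>v\<in>Poly_Mapping.keys q. ?t p u * ?t q v)"
    by (rule sum_product)
  also have "\<dots> \<in> R"
    using assms
    by (intro sum_in_R) (auto simp: mult_single intro!: single_closed intro: M_add mult_S lookup_in_S keys_in_M)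
  finally show ?thesis .
qed

end

section \<open>Comparisons of terms in a total cancellative preorder\<close>

locale valuation_order = submonoid_semiring S M + semiring_preorder "monoid_semiring S M" le
  for S and M :: "'m::ab_group_add set" and le (infix "\<preceq>" 50) +
  assumes total: "p \<in> R \<Longrightarrow> q \<in> R \<Longrightarrow> p \<preceq> q \<or> q \<preceq> p"
    and cancel: "c \<in> R \<Longrightarrow> p \<in> R \<Longrightarrow> q \<in> R \<Longrightarrow> c * p \<preceq> c * q \<Longrightarrow> c \<preceq> 0 \<or> p \<preceq> q"
    and nontrivial: "\<not> 1 \<preceq> 0"
begin

text \<open>The exponents whose monomials do not vanish in the quotient; a face by \<open>face_add_iff\<close> below.\<close>
definition face :: "'m set" where
  "face = {u \<in> M. \<not> Poly_Mapping.single u 1 \<preceq> 0}"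

lemma face_M: "u \<in> face \<Longrightarrow> u \<in> M" by (simp add: face_def)

lemma face_zero: "0 \<in> face"
  using nontrivial M_zero by (simp add: face_def)

lemma single_null_iff:
  assumes "u \<in> M" "a \<in> S" "a \<noteq> 0"
  shows "Poly_Mapping.single u a \<preceq> 0 \<longleftrightarrow> u \<notin> face"
proof -
  obtain b where b: "b \<in> S" "a * b = 1" using S assms by (auto simp: sub_semifield_def)
  have scale: "Poly_Mapping.single u (d * c) \<preceq> 0" if "Poly_Mapping.single u d \<preceq> 0" "c \<in> S" for c d
    using mult_right_mono[OF that(1) single_closed[OF M_zero that(2)]] by (simp add: mult_single)
  have "Poly_Mapping.single u a \<preceq> 0 \<longleftrightarrow> Poly_Mapping.single u 1 \<preceq> 0"
    using scale[of a b] scale[of 1 a] b assms by auto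
  then show ?thesis using assms by (simp add: face_def)
qed

lemma face_add_iff:
  assumes "u \<in> M" "v \<in> M"
  shows "u + v \<in> face \<longleftrightarrow> u \<in> face \<and> v \<in> face"
proof -
  let ?t = "\<lambda>u. Poly_Mapping.single u (1::trop)"
  have R: "?t u \<in> R" "?t v \<in> R" using assms one_S by (auto intro: single_closed)
  have prod: "?t u * ?t v = ?t (u + v)" by (simp add: mult_single)
  have "?t (u + v) \<preceq> 0 \<longleftrightarrow> ?t u \<preceq> 0 \<or> ?t v \<preceq> 0"
    using cancel[OF R zero_in_R] mult_right_mono[of "?t u" 0 "?t v"] mult_left_mono[of "?t v" 0 "?t u"] R
    by (auto simp: prod)
  then show ?thesis using assms M_add by (auto simp: face_def)
qed

text \<open>In a total order, a sum is equivalent to its largest summand.\<close>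
lemma dominant_term:
  assumes p: "p \<in> R" "p \<noteq> 0"
  obtains u where "u \<in> Poly_Mapping.keys p"
    "\<And>v. v \<in> Poly_Mapping.keys p \<Longrightarrow>
      Poly_Mapping.single v (Poly_Mapping.lookup p v) \<preceq> Poly_Mapping.single u (Poly_Mapping.lookup p u)"
    "p \<preceq> Poly_Mapping.single u (Poly_Mapping.lookup p u)"
proof -
  let ?t = "\<lambda>u. Poly_Mapping.single u (Poly_Mapping.lookup p u)"
  have t: "?t u \<in> R" if "u \<in> Poly_Mapping.keys p" for u
    using that p by (simp add: term_in_R)
  have "\<exists>u\<in>A. \<forall>v\<in>A. ?t v \<preceq> ?t u" if "finite A" "A \<noteq> {}" "A \<subseteq> Poly_Mapping.keys p" for A
    using that
  proof (induction rule: finite_ne_induct)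
    case (insert w A)
    then obtain u where u: "u \<in> A" "\<forall>v\<in>A. ?t v \<preceq> ?t u" by auto
    have R: "?t u \<in> R" "?t w \<in> R" using u insert t by auto
    then consider "?t w \<preceq> ?t u" | "?t u \<preceq> ?t w" using total by blast
    then show ?case
    proof cases
      case 1
      then show ?thesis using u by auto
    next
      case 2
      then have "\<forall>v\<in>A. ?t v \<preceq> ?t w" using u trans by blast
      then show ?thesis using R by auto
    qed
  qed (use t in auto)
  then obtain u where u: "u \<in> Poly_Mapping.keys p" "\<forall>v\<in>Poly_Mapping.keys p. ?t v \<preceq> ?t u"
    using p(2) by (metis finite_keys keys_eq_empty order_refl)
  have "(\<Sum>v\<in>Poly_Mapping.keys p. ?t v) \<preceq> ?t u" using u t by (intro sum_least) auto
  then have "p \<preceq> ?t u" by (simp flip: poly_mapping_sum_terms)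
  then show ?thesis using u that by blast
qed

lemma term_le:
  assumes p: "p \<in> R" and u: "u \<in> Poly_Mapping.keys p"
  shows "Poly_Mapping.single u (Poly_Mapping.lookup p u) \<preceq> p"
proof -
  let ?t = "\<lambda>u. Poly_Mapping.single u (Poly_Mapping.lookup p u)"
  have t: "?t v \<in> R" if "v \<in> Poly_Mapping.keys p" for v
    using that p by (simp add: term_in_R)
  have "p = ?t u + (\<Sum>v\<in>Poly_Mapping.keys p - {u}. ?t v)"
    using u sum.remove[of "Poly_Mapping.keys p" u ?t] by (simp flip: poly_mapping_sum_terms)
  moreover have "?t u \<preceq> ?t u + (\<Sum>v\<in>Poly_Mapping.keys p - {u}. ?t v)"
    using t u by (intro le_add_right sum_in_R) auto
  ultimately show ?thesis by simp
qed

text \<open>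
  The inequality that a comparison of two nonvanishing terms \<open>a \<chi>\<^sup>u \<preceq> b \<chi>\<^sup>v\<close> imposes on a point, with
  exponents written in the coordinates \<open>\<phi>\<close>.
\<close>
definition term_gap :: "('m \<Rightarrow> 'm \<Rightarrow> int) \<Rightarrow> bool \<Rightarrow> real \<Rightarrow> ('m \<Rightarrow> int) \<Rightarrow> bool" where
  "term_gap \<phi> s \<alpha> w \<longleftrightarrow>
     (\<exists>a\<in>S - {0}. \<exists>b\<in>S - {0}. \<exists>u\<in>face. \<exists>v\<in>face.
        \<alpha> = tlog a - tlog b \<and> w = (\<lambda>i. \<phi> u i - \<phi> v i) \<and>
        Poly_Mapping.single u a \<preceq> Poly_Mapping.single v b \<and>
        (s \<longrightarrow> \<not> Poly_Mapping.single v b \<preceq> Poly_Mapping.single u a))"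

text \<open>Multiply the two comparisons; strictness survives because nonvanishing terms are cancellable.\<close>
lemma term_gap_add:
  assumes \<phi>: "\<And>u v i. \<phi> (u + v) i = \<phi> u i + \<phi> v i"
    and K: "term_gap \<phi> s \<alpha> w" "term_gap \<phi> s' \<alpha>' w'"
  shows "term_gap \<phi> (s \<or> s') (\<alpha> + \<alpha>') (\<lambda>i. w i + w' i)"
proof -
  let ?t = "Poly_Mapping.single :: 'm \<Rightarrow> trop \<Rightarrow> _"
  have strict: "\<not> q * q' \<preceq> p * p'"
    if "p \<preceq> q" "p' \<preceq> q'" "\<not> q' \<preceq> p'" "\<not> q \<preceq> 0" for p q p' q'
  proof
    note R = closed[OF that(1)] closed[OF that(2)]
    assume "q * q' \<preceq> p * p'"
    also have "p * p' \<preceq> q * p'" using that R by (intro mult_right_mono) auto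
    finally show False using cancel[of q q' p'] that R by auto
  qed
  obtain a b u v where 1: "a \<in> S" "b \<in> S" "a \<noteq> 0" "b \<noteq> 0" "u \<in> face" "v \<in> face"
    "\<alpha> = tlog a - tlog b" "w = (\<lambda>i. \<phi> u i - \<phi> v i)" "?t u a \<preceq> ?t v b" "s \<longrightarrow> \<not> ?t v b \<preceq> ?t u a"
    using K(1) by (auto simp: term_gap_def)
  obtain a' b' u' v' where 2: "a' \<in> S" "b' \<in> S" "a' \<noteq> 0" "b' \<noteq> 0" "u' \<in> face" "v' \<in> face"
    "\<alpha>' = tlog a' - tlog b'" "w' = (\<lambda>i. \<phi> u' i - \<phi> v' i)" "?t u' a' \<preceq> ?t v' b'"
    "s' \<longrightarrow> \<not> ?t v' b' \<preceq> ?t u' a'"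
    using K(2) by (auto simp: term_gap_def)
  have prod: "?t u a * ?t u' a' = ?t (u + u') (a * a')" "?t v b * ?t v' b' = ?t (v + v') (b * b')"
    by (simp_all add: mult_single)
  have "?t (u + u') (a * a') \<preceq> ?t (v + v') (b * b')"
    using mult_mono[OF 1(9) 2(9)] by (simp add: prod)
  moreover have "\<not> ?t (v + v') (b * b') \<preceq> ?t (u + u') (a * a')" if "s \<or> s'"
  proof -
    have null: "\<not> ?t v b \<preceq> 0" "\<not> ?t v' b' \<preceq> 0"
      using 1 2 single_null_iff face_M by auto
    show ?thesis
      using that strict[OF 1(9) 2(9)] strict[OF 2(9) 1(9)] null 1(10) 2(10)
      unfolding prod[symmetric] by (metis mult.commute)
  qed
  moreover have "u + u' \<in> face" "v + v' \<in> face" using 1 2 face_add_iff face_M by auto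
  moreover have "\<alpha> + \<alpha>' = tlog (a * a') - tlog (b * b')"
    using 1 2 by (simp add: tlog_mult)
  moreover have "(\<lambda>i. w i + w' i) = (\<lambda>i. \<phi> (u + u') i - \<phi> (v + v') i)"
    using 1 2 by (simp add: \<phi> fun_eq_iff)
  moreover have "a * a' \<in> S - {0}" "b * b' \<in> S - {0}"
    using 1 2 mult_S trop_mult_nonzero by auto
  ultimately show ?thesis unfolding term_gap_def by blast
qed

text \<open>
  A comparison of two terms with the same exponent is a comparison of coefficients, and a larger
  coefficient absorbs a smaller one.
\<close>
lemma term_gap_constant:
  assumes inj: "\<And>u v. \<forall>b\<in>B. \<phi> u b = \<phi> v b \<Longrightarrow> u = v"
    and K: "term_gap \<phi> True \<alpha> w" and w: "\<forall>b\<in>B. w b = 0"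
  shows "\<alpha> < 0"
proof (rule ccontr)
  assume \<alpha>: "\<not> \<alpha> < 0"
  obtain a b u v where 1: "a \<in> S" "b \<in> S" "a \<noteq> 0" "b \<noteq> 0" "u \<in> face" "v \<in> face"
    "\<alpha> = tlog a - tlog b" "w = (\<lambda>i. \<phi> u i - \<phi> v i)"
    "\<not> Poly_Mapping.single v b \<preceq> Poly_Mapping.single u a"
    using K by (auto simp: term_gap_def)
  have "u = v" using w 1 by (intro inj) simp
  have "b + a = a" using 1 \<alpha> by (intro trop_add_absorb) auto
  then have "Poly_Mapping.single v b + Poly_Mapping.single u a = Poly_Mapping.single u a"
    using \<open>u = v\<close> by (simp flip: single_add)
  then have "Poly_Mapping.single v b \<preceq> Poly_Mapping.single u a"
    using le_add_right[of "Poly_Mapping.single v b" "Poly_Mapping.single u a"] 1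
    by (simp add: single_closed face_M)
  then show False using 1 by simp
qed

end

lemma toric_monoid_submonoid:
  assumes "sub_semifield S" "rational_polyhedral_cone \<sigma>"
  shows "submonoid_semiring S (toric_monoid \<sigma>)"
proof
  have add: "Modules.additive v" if v: "v \<in> \<sigma>" for v
  proof -
    obtain V c where V: "V \<subseteq> dual_lattice" "v = (\<lambda>u. \<Sum>w\<in>V. c w * w u)"
      using v assms(2) by (auto simp: rational_polyhedral_cone_def)
    have "w (x + y) = w x + w y" if "w \<in> V" for w x y
      using that V(1) by (auto simp: dual_lattice_def dual_space_def Modules.additive_def)
    then show ?thesis
      by (simp add: V(2) Modules.additive_def sum.distrib[symmetric] distrib_left[symmetric] cong: sum.cong)
  qed
  then show "0 \<in> toric_monoid \<sigma>" by (simp add: toric_monoid_def Modules.additive.zero)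
  show "u + v \<in> toric_monoid \<sigma>" if "u \<in> toric_monoid \<sigma>" "v \<in> toric_monoid \<sigma>" for u v
    using that add by (auto simp: toric_monoid_def Modules.additive.add add_nonpos_nonpos)
qed (rule assms(1))

section \<open>Realizing finitely many comparisons by a point\<close>

locale toric_valuation_order = valuation_order S "toric_monoid \<sigma>" le
  for S and \<sigma> :: "('m::ab_group_add \<Rightarrow> real) set" and le (infix "\<preceq>" 50)
begin

text \<open>
  Solving the inequalities coming from the terms of the polynomials in \<open>\<Phi>\<close> gives \<open>r\<close> and the restriction
  of \<open>x\<close> to the face. A polynomial and its dominant term are equivalent under \<open>\<preceq>\<close> and have equal
  values at \<open>(r, x)\<close>, so the comparison of polynomials reduces to that of terms.
\<close>
lemma realized_by_point:
  assumes free: "fg_free TYPE('m)" and \<Phi>: "finite \<Phi>" "\<Phi> \<subseteq> R"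
  obtains r x where "r \<ge> 0" "x \<in> extended_space \<sigma>"
    "\<And>p q. p \<in> \<Phi> \<Longrightarrow> q \<in> \<Phi> \<Longrightarrow> p \<preceq> q \<longleftrightarrow> trop_eval p (r, x) \<le> trop_eval q (r, x)"
proof -
  obtain B :: "'m set" and \<phi> :: "'m \<Rightarrow> 'm \<Rightarrow> int" where B: "finite B"
    "\<forall>u v b. \<phi> (u + v) b = \<phi> u b + \<phi> v b" "\<forall>u v. (\<forall>b\<in>B. \<phi> u b = \<phi> v b) \<longrightarrow> u = v"
    using free by (rule free_coordinates)
  have \<phi>: "\<And>u v b. \<phi> (u + v) b = \<phi> u b + \<phi> v b" "\<And>u v. \<forall>b\<in>B. \<phi> u b = \<phi> v b \<Longrightarrow> u = v"
    using B(2,3) by simp_all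
  let ?t = "\<lambda>(u, a). Poly_Mapping.single u a :: 'm \<Rightarrow>\<^sub>0 trop"
  define W where "W = (\<Union>p\<in>\<Phi>. (\<lambda>u. (u, Poly_Mapping.lookup p u)) ` (Poly_Mapping.keys p \<inter> face))"
  have W: "u \<in> face" "u \<in> toric_monoid \<sigma>" "a \<in> S" "a \<noteq> 0" if "(u, a) \<in> W" for u a
    using that \<Phi> face_M by (auto simp: W_def monoid_semiring_def in_keys_iff)
  have W_I: "(u, Poly_Mapping.lookup p u) \<in> W" if "p \<in> \<Phi>" "u \<in> Poly_Mapping.keys p" "u \<in> face" for p u
    using that by (auto simp: W_def)
  have W_R: "?t m \<in> R" if "m \<in> W" for m
    using that W by (cases m) (auto intro: single_closed)
  define gap where "gap = (\<lambda>((u, a), (v, b)).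
    (\<not> ?t (v, b) \<preceq> ?t (u, a), tlog a - tlog b, \<lambda>i. \<phi> u i - \<phi> v i))"
  have "\<exists>r\<ge>0. \<exists>c. \<forall>(s, \<alpha>, w)\<in>gap ` {mm \<in> W \<times> W. ?t (fst mm) \<preceq> ?t (snd mm)}.
      negative s (r * \<alpha> + (\<Sum>b\<in>B. c b * of_int (w b)))"
  proof (rule fourier_motzkin[of B "term_gap \<phi>"])
    show "term_gap \<phi> (s \<or> s') (\<alpha> + \<beta>) (\<lambda>b. v b + w b)"
      if "term_gap \<phi> s \<alpha> v" "term_gap \<phi> s' \<beta> w" for s s' \<alpha> \<beta> v w
      using \<phi>(1) that by (rule term_gap_add)
    show "\<alpha> < 0" if "term_gap \<phi> True \<alpha> v" "\<forall>b\<in>B. v b = 0" for \<alpha> v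
      using \<phi>(2) that by (rule term_gap_constant)
    have "finite W" using \<Phi> by (auto simp: W_def)
    then show "finite (gap ` {mm \<in> W \<times> W. ?t (fst mm) \<preceq> ?t (snd mm)})"
      by (intro finite_imageI) (auto intro: finite_subset[of _ "W \<times> W"])
    show "term_gap \<phi> s \<alpha> w" if in_image: "(s, \<alpha>, w) \<in> gap ` {mm \<in> W \<times> W. ?t (fst mm) \<preceq> ?t (snd mm)}" for s \<alpha> w
    proof -
      obtain mm where mm: "(s, \<alpha>, w) = gap mm" "mm \<in> {mm \<in> W \<times> W. ?t (fst mm) \<preceq> ?t (snd mm)}"
        using in_image by (rule imageE)
      obtain u a v b where "mm = ((u, a), (v, b))" by (metis surj_pair)
      with mm have "(u, a) \<in> W" "(v, b) \<in> W" "?t (u, a) \<preceq> ?t (v, b)"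
        "s \<longleftrightarrow> \<not> ?t (v, b) \<preceq> ?t (u, a)" "\<alpha> = tlog a - tlog b" "w = (\<lambda>i. \<phi> u i - \<phi> v i)"
        by (simp_all add: gap_def)
      then show ?thesis
        using W[of u a] W[of v b] unfolding term_gap_def
        by (intro bexI[of _ a] bexI[of _ b] bexI[of _ u] bexI[of _ v]) auto
    qed
  qed (rule B(1))
  then obtain r c where r: "r \<ge> 0" and c: "\<And>s \<alpha> w. (s, \<alpha>, w) \<in> gap ` {mm \<in> W \<times> W. ?t (fst mm) \<preceq> ?t (snd mm)}
      \<Longrightarrow> negative s (r * \<alpha> + (\<Sum>b\<in>B. c b * of_int (w b)))"
    by fastforce
  define y where "y u = (\<Sum>b\<in>B. c b * of_int (\<phi> u b))" for u
  define val where "val = (\<lambda>(u, a). r * tlog a + y u)"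
  define x where "x u = (if u \<in> toric_monoid \<sigma> then if u \<in> face then ereal (y u) else - \<infinity> else undefined)" for u
  have y_add: "y (u + v) = y u + y v" for u v
    by (simp add: y_def \<phi>(1) distrib_left sum.distrib)
  then have y_zero: "y 0 = 0" by (metis add_cancel_right_left add_0)
  \<comment> \<open>Additive also across the boundary: a sum of exponents is in the face only if both summands are.\<close>
  have x: "x \<in> extended_space \<sigma>"
    using M_zero M_add face_zero y_zero face_add_iff
    by (auto simp: extended_space_def x_def y_add PiE_def extensional_def)
  have val_gap: "negative (\<not> ?t m' \<preceq> ?t m) (val m - val m')" if "m \<in> W" "m' \<in> W" "?t m \<preceq> ?t m'" for m m'
  proof -
    obtain u a v b where m: "m = (u, a)" "m' = (v, b)" by (cases m, cases m')
    have "gap (m, m') \<in> gap ` {mm \<in> W \<times> W. ?t (fst mm) \<preceq> ?t (snd mm)}"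
      using that by (intro imageI) simp
    moreover have "gap (m, m') = (\<not> ?t m' \<preceq> ?t m, tlog a - tlog b, \<lambda>i. \<phi> u i - \<phi> v i)"
      by (simp add: gap_def m)
    ultimately have "negative (\<not> ?t m' \<preceq> ?t m)
        (r * (tlog a - tlog b) + (\<Sum>i\<in>B. c i * of_int (\<phi> u i - \<phi> v i)))"
      by (intro c) (simp only:)
    then show ?thesis by (simp add: m val_def y_def algebra_simps sum_subtractf)
  qed
  have val_le: "?t m \<preceq> ?t m' \<longleftrightarrow> val m \<le> val m'" if "m \<in> W" "m' \<in> W" for m m'
    using val_gap[OF that] val_gap[OF that(2,1)] total[OF W_R[OF that(1)] W_R[OF that(2)]]
    by (auto simp: negative_def split: if_splits)
  have eval_term: "ereal r * trop_log (Poly_Mapping.lookup p u) + x u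
      = (if u \<in> face then ereal (val (u, Poly_Mapping.lookup p u)) else - \<infinity>)"
    if "p \<in> \<Phi>" "u \<in> Poly_Mapping.keys p" for p u
  proof -
    have "Poly_Mapping.lookup p u \<noteq> 0" "u \<in> toric_monoid \<sigma>"
      using that \<Phi> keys_in_M[of p u] by (auto simp: in_keys_iff)
    then show ?thesis by (simp add: trop_log_nonzero x_def val_def)
  qed
  have eval: "(p \<preceq> 0 \<and> trop_eval p (r, x) = - \<infinity>) \<or>
      (\<exists>m\<in>W. p \<preceq> ?t m \<and> ?t m \<preceq> p \<and> trop_eval p (r, x) = ereal (val m))" if p: "p \<in> \<Phi>" for p
  proof (cases "p = 0")
    case True
    then show ?thesis using zero_in_R by (simp add: trop_eval_def)
  next
    case False
    have pR: "p \<in> R" using p \<Phi> by auto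
    let ?m = "\<lambda>u. (u, Poly_Mapping.lookup p u)"
    obtain u where u: "u \<in> Poly_Mapping.keys p"
      "\<And>v. v \<in> Poly_Mapping.keys p \<Longrightarrow> ?t (?m v) \<preceq> ?t (?m u)" "p \<preceq> ?t (?m u)"
      using dominant_term[OF pR False] by auto
    have null: "?t (?m v) \<preceq> 0 \<longleftrightarrow> v \<notin> face" if "v \<in> Poly_Mapping.keys p" for v
      using that single_null_iff[OF keys_in_M[OF pR that] lookup_in_S[OF pR]] by (simp add: in_keys_iff)
    have ev: "trop_eval p (r, x) =
        Max ((\<lambda>v. if v \<in> face then ereal (val (?m v)) else - \<infinity>) ` Poly_Mapping.keys p)"
      using False p by (simp add: trop_eval_def eval_term cong: image_cong)
    show ?thesis
    proof (cases "u \<in> face")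
      case True
      have "val (?m v) \<le> val (?m u)" if "v \<in> Poly_Mapping.keys p" "v \<in> face" for v
        using that u True p val_le[of "?m v" "?m u"] W_I by auto
      then have "trop_eval p (r, x) = ereal (val (?m u))"
        unfolding ev using u(1) True by (intro Max_eqI) auto
      then show ?thesis using u(3) term_le[OF pR u(1)] W_I[OF p u(1) True]
        by (intro disjI2 bexI[of _ "?m u"]) auto
    next
      case False
      then have "?t (?m u) \<preceq> 0" using null u(1) by blast
      then have "p \<preceq> 0" "\<And>v. v \<in> Poly_Mapping.keys p \<Longrightarrow> ?t (?m v) \<preceq> 0"
        using u trans by blast+
      then have "\<And>v. v \<in> Poly_Mapping.keys p \<Longrightarrow> v \<notin> face" using null by blast
      then have "trop_eval p (r, x) = - \<infinity>"
        unfolding ev using u(1) by (intro Max_eqI) auto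
      then show ?thesis using \<open>p \<preceq> 0\<close> by simp
    qed
  qed
  have W_null: "\<not> ?t m \<preceq> 0" if "m \<in> W" for m
    using that W single_null_iff by (cases m) auto
  have "p \<preceq> q \<longleftrightarrow> trop_eval p (r, x) \<le> trop_eval q (r, x)" if pq: "p \<in> \<Phi>" "q \<in> \<Phi>" for p q
    using eval[OF pq(1)]
  proof (elim disjE bexE conjE)
    assume "p \<preceq> 0" "trop_eval p (r, x) = - \<infinity>"
    moreover have "p \<preceq> q" using \<open>p \<preceq> 0\<close> trans zero_least pq \<Phi> by blast
    ultimately show ?thesis by simp
  next
    fix m assume m: "m \<in> W" "p \<preceq> ?t m" "?t m \<preceq> p" "trop_eval p (r, x) = ereal (val m)"
    show ?thesis
      using eval[OF pq(2)]
    proof (elim disjE bexE conjE)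
      assume q: "q \<preceq> 0" "trop_eval q (r, x) = - \<infinity>"
      then have "\<not> p \<preceq> q" using W_null[OF m(1)] m(3) trans by blast
      then show ?thesis using q m by simp
    next
      fix m' assume m': "m' \<in> W" "q \<preceq> ?t m'" "?t m' \<preceq> q" "trop_eval q (r, x) = ereal (val m')"
      have "p \<preceq> q \<longleftrightarrow> ?t m \<preceq> ?t m'" using m m' trans by blast
      then show ?thesis using val_le[OF m(1) m'(1)] m m' by simp
    qed
  qed
  then show ?thesis using that r x by blast
qed

end

section \<open>The Nullstellensatz\<close>

theorem theorem1p2:
  fixes S :: "trop set"
    and \<sigma> :: "('m::ab_group_add \<Rightarrow> real) set"
    and E :: "(('m \<Rightarrow>\<^sub>0 trop) \<times> ('m \<Rightarrow>\<^sub>0 trop)) set"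
    and f g :: "'m \<Rightarrow>\<^sub>0 trop"
  assumes "sub_semifield S"
    and "fg_free TYPE('m)"
    and "rational_polyhedral_cone \<sigma>"
    and "strongly_convex \<sigma>"
    and "congruence (monoid_semiring S (toric_monoid \<sigma>)) E"
    and "has_finite_tropical_basis \<sigma> E"
    and "f \<in> monoid_semiring S (toric_monoid \<sigma>)"
    and "g \<in> monoid_semiring S (toric_monoid \<sigma>)"
    and "\<forall>w \<in> trop_locus \<sigma> E. trop_eval f w = trop_eval g w"
  shows "\<exists>(i::nat). \<exists>h \<in> monoid_semiring S (toric_monoid \<sigma>).
           (((f + g) ^ i + h) * f, ((f + g) ^ i + h) * g) \<in> E"
proof (rule ccontr)
  assume no: "\<not> ?thesis"
  interpret submonoid_semiring S "toric_monoid \<sigma>"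
    using assms(1,3) by (rule toric_monoid_submonoid)
  define le0 where "le0 = (\<lambda>a b. (a + b, b) \<in> E \<and> a \<in> R \<and> b \<in> R)"
  interpret pre: semiring_preorder R le0
    unfolding le0_def using assms(5)
    by (intro congruence_preorder zero_in_R one_in_R add_in_R mult_in_R poly_mapping_trop_idem)
  have E_R: "a \<in> R \<and> b \<in> R" if "(a, b) \<in> E" for a b
    using that assms(5) by (auto simp: congruence_def equiv_def)
  have E_sym: "(b, a) \<in> E" if "(a, b) \<in> E" for a b
    using that assms(5) by (auto simp: congruence_def equiv_def dest: symD)
  have E_trans: "(a, c) \<in> E" if "(a, b) \<in> E" "(b, c) \<in> E" for a b c
    using that assms(5) unfolding congruence_def equiv_def by (meson transD)
  have E_le: "le0 a b" if "(a, b) \<in> E" for a b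
  proof -
    have "(b, b) \<in> E" using E_sym E_trans that by blast
    then have "(a + b, b + b) \<in> E" using that assms(5) unfolding congruence_def by blast
    then show ?thesis using E_R[OF that] by (simp add: le0_def poly_mapping_trop_idem)
  qed
  have le_E: "(a, b) \<in> E" if "le0 a b" "le0 b a" for a b
    using that E_sym E_trans by (metis add.commute le0_def)
  have "separates R f g le0"
    using no le_E by (auto simp: separates_def shifted_powers_def)
  then obtain le where le: "\<forall>x y. le0 x y \<longrightarrow> le x y" and max: "maximal_separating R le f g"
    using pre.exists_maximal_separating assms(7,8) by blast
  interpret maximal_separating R le f g by (rule max)
  interpret toric_valuation_order S \<sigma> le
  proof
    show "le p q \<or> le q p" if "p \<in> R" "q \<in> R" for p q using total that .
    show "le c 0 \<or> le p q" if "c \<in> R" "p \<in> R" "q \<in> R" "le (c * p) (c * q)" for c p q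
      using cancel that .
    show "\<not> le 1 0"
    proof
      assume *: "le 1 0"
      have null: "le p 0" if "p \<in> R" for p using mult_right_mono[OF * that] by simp
      have "le p q" if "p \<in> R" "q \<in> R" for p q
        using null[OF that(1)] zero_least[OF that(2)] by (rule trans)
      then show False using not_equivalent_base assms(7,8) by blast
    qed
  qed
  obtain F where F: "F \<subseteq> E" "finite F" "trop_locus \<sigma> E = trop_locus \<sigma> F"
    using assms(6) by (auto simp: has_finite_tropical_basis_def)
  define \<Phi> where "\<Phi> = {f, g} \<union> fst ` F \<union> snd ` F"
  have "finite \<Phi>" "\<Phi> \<subseteq> R" using F E_R assms(7,8) by (auto simp: \<Phi>_def)
  then obtain r x where r: "r \<ge> 0" and x: "x \<in> extended_space \<sigma>" and
    order: "\<And>p q. p \<in> \<Phi> \<Longrightarrow> q \<in> \<Phi> \<Longrightarrow> le p q \<longleftrightarrow> trop_eval p (r, x) \<le> trop_eval q (r, x)"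
    using realized_by_point[OF assms(2)] by blast
  have "trop_eval p (r, x) = trop_eval q (r, x)" if "(p, q) \<in> F" for p q
  proof -
    have "p \<in> \<Phi>" "q \<in> \<Phi>" using that by (force simp: \<Phi>_def)+
    moreover have "le p q" "le q p" using that F(1) E_le E_sym le by blast+
    ultimately show ?thesis using order by (simp add: antisym)
  qed
  then have "(r, x) \<in> trop_locus \<sigma> F" using r x by (auto simp: trop_locus_def)
  then have "trop_eval f (r, x) = trop_eval g (r, x)" using F(3) assms(9) by blast
  then have "le f g" "le g f" using order by (auto simp: \<Phi>_def)
  then show False by (rule not_equivalent_base)
qed

end
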